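(* The Weber kernel group $\Gamma_8$ is the group generated by $\Gamma(16)$ and $\begin{pmatrix}13&8\\8&5\end{pmatrix}$.
   Context: Write $\zeta_k=e^{2\pi i/k}$. Let $\eta$ be the Dedekind eta function and $$\mathfrak{f}(\tau)=\zeta_{48}^{-1}\frac{\eta\left(\frac{\tau+1}{2}\right)}{\eta(\tau)},\quad \mathfrak{f}_1(\tau)=\frac{\eta\left(\frac{\tau}{2}\right)}{\eta(\tau)},\quad \mathfrak{f}_2(\tau)=\sqrt2\,\frac{\eta(2\tau)}{\eta(\tau)},$$ $(\mathfrak{u}_0,\mathfrak{u}_1,\mathfrak{u}_2)=(\mathfrak{f},\zeta_{16}\mathfrak{f}_1,\zeta_{16}^{-1}\mathfrak{f}_2)$. The Weber kernel group $\Gamma_8\subset\mathrm{PSL}_2(\mathbb{Z})$ is the group of all $g$ with $\mathfrak{u}_i^{3}\circ g=\mathfrak{u}_i^{3}$ for $i=0,1,2$. Here $\Gamma(16)$ denotes the principal congruence subgroup of level $16$, and $\Gamma(16)$ and the matrix $\begin{pmatrix}13&8\\8&5\end{pmatrix}\in\mathrm{SL}_2(\mathbb{Z})$ are regarded in $\mathrm{PSL}_2(\mathbb{Z})$ via their images. *)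

theory Defs
  imports
    "HOL-Analysis.Analysis"
    "HOL-Algebra.Generated_Groups"
    "HOL-Number_Theory.Cong"
begin

definition upper_half_plane :: "complex set" where
  "upper_half_plane = {\<tau>. Im \<tau> > 0}"

definition zeta_root :: "nat \<Rightarrow> complex" where
  "zeta_root k = exp (2 * of_real pi * \<i> / of_nat k)"

(* Product formula q^(1/24) * (1 - q) * (1 - q^2) * ... with q = exp (2 pi i tau);
   only meaningful for tau in the upper half-plane. The product index is shifted by one. *)
definition dedekind_eta :: "complex \<Rightarrow> complex" where
  "dedekind_eta \<tau> = exp (2 * of_real pi * \<i> * \<tau> / 24) *
     (\<Prod>n. 1 - exp (2 * of_real pi * \<i> * \<tau>) ^ Suc n)"

definition weber_f :: "complex \<Rightarrow> complex" where
  "weber_f \<tau> = inverse (zeta_root 48) * (dedekind_eta ((\<tau> + 1) / 2) / dedekind_eta \<tau>)"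

definition weber_f1 :: "complex \<Rightarrow> complex" where
  "weber_f1 \<tau> = dedekind_eta (\<tau> / 2) / dedekind_eta \<tau>"

definition weber_f2 :: "complex \<Rightarrow> complex" where
  "weber_f2 \<tau> = of_real (sqrt 2) * (dedekind_eta (2 * \<tau>) / dedekind_eta \<tau>)"

(* Only the indices 0, 1, 2 are meaningful. *)
definition weber_u :: "nat \<Rightarrow> complex \<Rightarrow> complex" where
  "weber_u i \<tau> =
     (if i = 0 then weber_f \<tau>
      else if i = 1 then zeta_root 16 * weber_f1 \<tau>
      else inverse (zeta_root 16) * weber_f2 \<tau>)"

definition SL2Z :: "(int^2^2) monoid" where
  "SL2Z = \<lparr>carrier = {A. det A = 1}, mult = (**), one = mat 1\<rparr>"

abbreviation pm_one :: "(int^2^2) set" where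
  "pm_one \<equiv> {mat 1, - mat 1}"

(* The elements of PSL2Z are the cosets {A, -A}. *)
definition PSL2Z :: "(int^2^2) set monoid" where
  "PSL2Z = SL2Z Mod pm_one"

definition to_PSL2Z :: "int^2^2 \<Rightarrow> (int^2^2) set" where
  "to_PSL2Z A = pm_one #>\<^bsub>SL2Z\<^esub> A"

definition principal_congruence_subgroup :: "int \<Rightarrow> (int^2^2) set" where
  "principal_congruence_subgroup N =
     {A \<in> carrier SL2Z. \<forall>i j. [A $ i $ j = mat 1 $ i $ j] (mod N)}"

definition moebius_action :: "int^2^2 \<Rightarrow> complex \<Rightarrow> complex" where
  "moebius_action A \<tau> =
     (of_int (A $ 1 $ 1) * \<tau> + of_int (A $ 1 $ 2)) / (of_int (A $ 2 $ 1) * \<tau> + of_int (A $ 2 $ 2))"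

lemma moebius_action_uminus: "moebius_action (- A) \<tau> = moebius_action A \<tau>"
proof -
  have "(- x - y) / (- z - w) = (x + y) / (z + w)" for x y z w :: complex
    using minus_divide_divide[of "x + y" "z + w"] by simp
  then show ?thesis
    by (simp add: moebius_action_def)
qed

(* An element g of PSL2Z acts through any of its representatives A; by moebius_action_uminus
   the choice is irrelevant. *)
definition weber_kernel_8 :: "(int^2^2) set set" where
  "weber_kernel_8 =
     {g \<in> carrier PSL2Z. \<forall>A\<in>g. \<forall>i\<in>{0, 1, 2}. \<forall>\<tau>\<in>upper_half_plane.
        weber_u i (moebius_action A \<tau>) ^ 3 = weber_u i \<tau> ^ 3}"

lemma group_SL2Z: "group SL2Z"
proof (rule groupI)
  fix A assume "A \<in> carrier SL2Z"
  then have d: "A $ 1 $ 1 * A $ 2 $ 2 - A $ 1 $ 2 * A $ 2 $ 1 = 1"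
    by (simp add: SL2Z_def det_2)
  let ?B = "vector [vector [A $ 2 $ 2, - A $ 1 $ 2], vector [- A $ 2 $ 1, A $ 1 $ 1]] :: int^2^2"
  have "?B \<in> carrier SL2Z"
    using d by (simp add: SL2Z_def det_2 algebra_simps)
  moreover have "?B ** A = mat 1"
    using d by (simp add: vec_eq_iff forall_2 matrix_matrix_mult_def sum_2 mat_def algebra_simps)
  ultimately show "\<exists>B\<in>carrier SL2Z. B \<otimes>\<^bsub>SL2Z\<^esub> A = \<one>\<^bsub>SL2Z\<^esub>"
    by (intro bexI[of _ ?B]) (simp_all add: SL2Z_def)
qed (simp_all add: SL2Z_def det_mul matrix_mul_assoc)

lemma normal_pm_one: "pm_one \<lhd> SL2Z"
proof -
  interpret group SL2Z by (rule group_SL2Z)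
  have neg: "(- mat 1) ** A = - A" "A ** (- mat 1) = - A" for A :: "int^2^2"
    by (simp_all add: vec_eq_iff forall_2 matrix_matrix_mult_def sum_2 mat_def)
  have neg1: "- mat 1 \<in> carrier SL2Z"
    by (simp add: SL2Z_def det_2 mat_def)
  have sub: "subgroup pm_one SL2Z"
  proof (rule subgroupI)
    have "inv\<^bsub>SL2Z\<^esub> (- mat 1) = - mat 1"
      using neg1 by (intro inv_equality) (simp_all add: SL2Z_def neg)
    moreover have "inv\<^bsub>SL2Z\<^esub> (mat 1) = mat 1"
      using inv_one by (simp add: SL2Z_def)
    ultimately show "inv\<^bsub>SL2Z\<^esub> A \<in> pm_one" if "A \<in> pm_one" for A
      using that by auto
  qed (use neg1 in \<open>auto simp: SL2Z_def neg\<close>)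
  show ?thesis
    by (rule normalI[OF sub]) (auto simp: r_coset_def l_coset_def SL2Z_def neg)
qed

lemma group_PSL2Z: "group PSL2Z"
  unfolding PSL2Z_def by (rule normal.factorgroup_is_group[OF normal_pm_one])

end

theory Submission
  imports Defs
begin

text \<open>
  Taking logarithms of the eta products turns \<open>f\<^sub>2(\<tau>)\<close> and \<open>f\<^sub>1(-1/\<tau>)\<close> into sums of cotangents;
  after expansion in partial fractions the two differ only in the order of summation of the double
  series of \<open>(-1)\<^sup>m / (m\<^sup>2\<tau>\<^sup>2 - n\<^sup>2)\<close>. This gives \<open>f\<^sub>1(-1/\<tau>) = f\<^sub>2(\<tau>)\<close> without the modularity
  of eta itself. Together with the evident laws under \<open>\<tau> \<mapsto> \<tau> + 1\<close>, a Euclidean descent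
  on \<open>(a, c)\<close> shows that a matrix of determinant 1 with \<open>c\<close> even multiplies \<open>u\<^sub>2\<^sup>3\<close> by
  \<open>\<zeta>\<close> to the power \<open>2ab + ac + a\<^sup>2 - 1\<close>, where \<open>\<zeta>\<close> is the primitive 16th root of unity,
  while no matrix with \<open>c\<close> odd fixes \<open>u\<^sub>2\<^sup>3\<close>. Since
  \<open>u\<^sub>0\<^sup>3\<close> and \<open>u\<^sub>1\<^sup>3\<close> are translates of \<open>u\<^sub>2\<^sup>3\<close>, the kernel consists of the matrices with \<open>b\<close> even and
  \<open>b \<equiv> c \<equiv> a\<^sup>2 - 1\<close> modulo 16, and up to sign these are \<open>\<Gamma>(16)\<close> times powers of the given matrix.
\<close>

subsection \<open>Partial fractions and double series\<close>

text \<open>Differentiating both sides of the reflection formula for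
  \<open>Gamma z * Gamma (1 - z)\<close> gives
  \<open>Digamma (1 - z) - Digamma z = pi * cot (pi * z)\<close>; the series of
  \<open>Digamma\<close> then supplies the partial fractions.\<close>

lemma cot_partial_fractions:
  fixes z :: complex
  assumes "z \<notin> \<int>"
  shows "(\<lambda>n. 2 * z / (z ^ 2 - of_nat (Suc n) ^ 2)) sums (pi * cot (pi * z) - 1 / z)"
proof -
  have z0: "z \<noteq> 0" "1 - z \<noteq> 0"
    using assms by auto
  have "1 - z \<notin> \<int>"
    using assms by (metis Ints_1 Ints_diff diff_diff_eq2 add_diff_cancel_left')
  with assms have nonpos: "z \<notin> \<int>\<^sub>\<le>\<^sub>0" "1 - z \<notin> \<int>\<^sub>\<le>\<^sub>0"
    using nonpos_Ints_Int by auto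
  have s0: "sin (pi * z) \<noteq> 0"
  proof
    assume "sin (pi * z) = 0"
    then obtain n :: int where "pi * z = of_real (n * pi)"
      by (auto simp: sin_eq_0)
    then have "z = of_int n" by simp
    with assms show False by simp
  qed
  let ?G = "Gamma z * Gamma (1 - z)"
  have "((\<lambda>z. Gamma z * Gamma (1 - z)) has_field_derivative
          ?G * (Digamma z - Digamma (1 - z))) (at z)"
    using nonpos by (auto intro!: derivative_eq_intros simp: algebra_simps)
  moreover have "((\<lambda>z. Gamma z * Gamma (1 - z)) has_field_derivative
          - (pi * (pi * cos (pi * z))) / (sin (pi * z))\<^sup>2) (at z)"
    unfolding Gamma_reflection_complex using s0
    by (auto intro!: derivative_eq_intros simp: power2_eq_square)
  ultimately have "?G * (Digamma z - Digamma (1 - z)) = - (pi * (pi * cos (pi * z))) / (sin (pi * z))\<^sup>2"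
    by (rule DERIV_unique)
  then have "pi / sin (pi * z) * (Digamma (1 - z) - Digamma z)
      = pi / sin (pi * z) * (pi * cot (pi * z))"
    unfolding Gamma_reflection_complex by (simp add: cot_def power2_eq_square algebra_simps)
  then have cot: "Digamma (1 - z) - Digamma z = pi * cot (pi * z)"
    using s0 by simp
  define A where "A n = inverse (z + of_nat n)" for n
  define B where "B n = inverse (1 - z + of_nat n)" for n
  have "(\<lambda>n. A n - B n) sums (Digamma (1 - z) - Digamma z)"
    using sums_diff[OF summable_sums[OF summable_Digamma[OF z0(2)]] summable_sums[OF summable_Digamma[OF z0(1)]]]
    by (simp add: Digamma_def A_def B_def)
  \<comment> \<open>Adding this telescoping series shifts \<open>A\<close> by one, so that
    \<open>z + (n + 1)\<close> and \<open>(n + 1) - z\<close> meet in the same term; its sum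
    \<open>- A 0\<close> is the \<open>- 1 / z\<close> of the claim.\<close>
  moreover have "(\<lambda>n. A (Suc n) - A n) sums (0 - A 0)"
    unfolding A_def
    by (intro telescope_sums filterlim_compose[OF tendsto_inverse_0]
              tendsto_add_filterlim_at_infinity[OF tendsto_const] tendsto_of_nat)
  ultimately have "(\<lambda>n. A n - B n + (A (Suc n) - A n)) sums (Digamma (1 - z) - Digamma z + (0 - A 0))"
    by (rule sums_add)
  moreover have "A n - B n + (A (Suc n) - A n) = 2 * z / (z ^ 2 - of_nat (Suc n) ^ 2)" for n
  proof -
    have "z \<noteq> of_nat (Suc n)" "z \<noteq> - of_nat (Suc n)"
      using assms by (metis Ints_of_nat, metis Ints_minus Ints_of_nat)
    then have ne: "z + of_nat (Suc n) \<noteq> 0" "1 - z + of_nat n \<noteq> 0"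
      by (auto simp: add_eq_0_iff algebra_simps)
    have "A (Suc n) - B n = (1 - z + of_nat n - (z + of_nat (Suc n))) / ((z + of_nat (Suc n)) * (1 - z + of_nat n))"
      using ne unfolding A_def B_def by (simp add: divide_simps)
    also have "\<dots> = (- (2 * z)) / (- (z ^ 2 - of_nat (Suc n) ^ 2))"
      by (intro arg_cong2[of _ _ _ _ "(/)"]) (simp_all add: algebra_simps power2_eq_square)
    finally show ?thesis by (simp only: minus_divide_divide) simp
  qed
  ultimately show ?thesis
    by (simp add: cot A_def inverse_eq_divide)
qed

text \<open>The product bound makes the family absolutely summable over pairs, so the exchange
  theorem for unordered sums applies; the rest translates \<open>infsum\<close> back into
  \<open>suminf\<close>.\<close>

lemma suminf_swap_dominated:
  fixes f :: "nat \<Rightarrow> nat \<Rightarrow> complex" and g h :: "nat \<Rightarrow> real"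
  assumes le: "\<And>i j. norm (f i j) \<le> g i * h j"
    and nonneg: "\<And>i. g i \<ge> 0" "\<And>j. h j \<ge> 0" and sum: "summable g" "summable h"
  shows "(\<lambda>i. \<Sum>j. f i j) sums (\<Sum>j. \<Sum>i. f i j)"
proof -
  have gh: "g summable_on UNIV" "h summable_on UNIV"
    using sum nonneg by (auto intro!: norm_summable_imp_summable_on)
  have "(\<lambda>(i, j). g i * h j) summable_on UNIV \<times> UNIV"
    using gh nonneg
    by (intro summable_on_SigmaI[where g = "\<lambda>i. g i * infsum h UNIV"])
       (auto intro!: has_sum_cmult_right summable_on_cmult_left)
  then have "(\<lambda>x. norm ((\<lambda>(i, j). f i j) x)) summable_on UNIV \<times> UNIV"
    by (rule Infinite_Sum.abs_summable_on_comparison_test') (auto simp: le)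
  then have F: "(\<lambda>(i, j). f i j) summable_on UNIV \<times> UNIV"
    by (rule abs_summable_summable)
  have row: "f i summable_on UNIV" for i
    using summable_on_SigmaD1[OF F, of i] by simp
  have F': "(\<lambda>(j, i). f i j) summable_on UNIV \<times> UNIV"
    using F by (subst summable_on_swap) simp
  have col: "(\<lambda>i. f i j) summable_on UNIV" for j
    using summable_on_SigmaD1[OF F', of j] by simp
  have inf: "infsum u UNIV = suminf u" if "u summable_on UNIV" for u :: "nat \<Rightarrow> complex"
    using that by (metis has_sum_imp_sums has_sum_infsum sums_unique)
  have row': "(\<lambda>i. infsum (f i) UNIV) summable_on UNIV"
    using summable_on_Sigma_banach[OF F] .
  have col': "(\<lambda>j. infsum (\<lambda>i. f i j) UNIV) summable_on UNIV"
    using summable_on_Sigma_banach[OF F'] .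
  have "(\<Sum>i. infsum (f i) UNIV) = (\<Sum>j. infsum (\<lambda>i. f i j) UNIV)"
    using infsum_swap_banach[OF F] unfolding inf[OF row'] inf[OF col'] .
  moreover have "summable (\<lambda>i. infsum (f i) UNIV)"
    using row' by (rule summable_on_imp_summable)
  ultimately show ?thesis
    unfolding inf[OF row] inf[OF col] by (simp only: sums_iff)
qed

lemma sums_pair:
  fixes f :: "nat \<Rightarrow> 'a::real_normed_vector"
  assumes "f sums s"
  shows "(\<lambda>j. f (2 * j) + f (2 * j + 1)) sums s"
  using sums_group[OF assms, of 2] by (simp add: mult.commute numeral_2_eq_2)

text \<open>Even indices cancel and odd ones double. In the applications index \<open>m\<close>
  stands for the integer \<open>m + 1\<close>, so this isolates the terms at even integers.\<close>

lemma sums_double_even: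
  fixes f :: "nat \<Rightarrow> 'a::real_normed_field"
  assumes "f sums s" "(\<lambda>m. (-1) ^ m * f m) sums t"
  shows "(\<lambda>j. 2 * f (2 * j + 1)) sums (s - t)"
  using sums_diff[OF sums_pair[OF assms(1)] sums_pair[OF assms(2)]] by simp

subsection \<open>Logarithm of the eta product\<close>

definition lambert :: "complex \<Rightarrow> complex" where
  "lambert z = exp (2 * of_real pi * \<i> * z) / (1 - exp (2 * of_real pi * \<i> * z))"

text \<open>With \<open>q = exp (2 * pi * \<i> * \<tau>)\<close> this is the sum of
  \<open>q^k / (k * (1 - q^k))\<close> over \<open>k \<ge> 1\<close>, that is, minus a logarithm of
  the product of all \<open>1 - q^n\<close>.\<close>

definition lambert_series :: "complex \<Rightarrow> complex" where
  "lambert_series \<tau> = (\<Sum>k. lambert (of_nat (Suc k) * \<tau>) / of_nat (Suc k))"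

lemma norm_nome_less_1:
  assumes "Im z > 0"
  shows "norm (exp (2 * of_real pi * \<i> * z)) < 1"
  using assms by (simp add: norm_exp_eq_Re)

lemma not_Ints_if_Im_pos: "Im z > 0 \<Longrightarrow> z \<notin> \<int>"
  by (auto elim!: Ints_cases)

text \<open>Both sides are the same rational function of \<open>u = exp (\<i> * pi * z)\<close>,
  whose square is the nome.\<close>

lemma lambert_eq_cot:
  fixes z :: complex
  assumes "Im z > 0"
  shows "lambert z = \<i> / 2 * cot (pi * z) - 1 / 2"
proof -
  define u where "u = exp (\<i> * (pi * z))"
  have u0: "u \<noteq> 0" by (simp add: u_def)
  have x: "exp (2 * of_real pi * \<i> * z) = u ^ 2"
    unfolding u_def by (simp flip: exp_of_nat_mult add: algebra_simps)
  have "u ^ 2 \<noteq> 1"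
    using norm_nome_less_1[OF assms] unfolding x by auto
  then have u1: "u * u - 1 \<noteq> 0" "1 - u * u \<noteq> 0" by (auto simp: power2_eq_square)
  have inv: "exp (- (\<i> * (pi * z))) = 1 / u"
    by (simp add: u_def exp_minus inverse_eq_divide)
  have "cot (pi * z) = \<i> * (u ^ 2 + 1) / (u ^ 2 - 1)"
    unfolding cot_def sin_exp_eq cos_exp_eq inv u_def[symmetric] using u0 u1
    by (simp add: divide_simps power2_eq_square) (simp add: algebra_simps)?
  then show ?thesis
    unfolding lambert_def x using u1 by (simp add: divide_simps power2_eq_square) (simp add: algebra_simps)?
qed

lemma lambert_partial_fractions:
  assumes "Im z > 0"
  shows "(\<lambda>n. 2 * z / (z ^ 2 - of_nat (Suc n) ^ 2)) sums (- 2 * pi * \<i> * (lambert z + 1 / 2) - 1 / z)"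
  using cot_partial_fractions[OF not_Ints_if_Im_pos[OF assms]]
  by (simp add: lambert_eq_cot[OF assms] algebra_simps)

lemma exp_nome_power:
  "exp (2 * of_real pi * \<i> * (of_nat k * z)) = exp (2 * of_real pi * \<i> * z) ^ k"
  by (simp flip: exp_of_nat_mult add: algebra_simps)

lemma summable_norm_lambert_series:
  assumes "Im \<tau> > 0"
  shows "summable (\<lambda>k. norm (lambert (of_nat (Suc k) * \<tau>) / of_nat (Suc k)))"
proof -
  define q where "q = exp (2 * of_real pi * \<i> * \<tau>)"
  have q: "norm q < 1" using norm_nome_less_1[OF assms] by (simp add: q_def)
  have le: "norm (lambert (of_nat (Suc k) * \<tau>) / of_nat (Suc k)) \<le> norm q ^ k / (1 - norm q)" for k
  proof -
    have l: "lambert (of_nat (Suc k) * \<tau>) = q ^ Suc k / (1 - q ^ Suc k)"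
      unfolding lambert_def exp_nome_power q_def by (rule refl)
    have "norm q ^ Suc k \<le> norm q ^ 1" "norm q ^ Suc k \<le> norm q ^ k"
      using q by (intro power_decreasing; simp)+
    moreover have "1 - norm (q ^ Suc k) \<le> norm (1 - q ^ Suc k)"
      using norm_triangle_ineq2[of 1 "q ^ Suc k"] by simp
    ultimately have "norm (q ^ Suc k) / norm (1 - q ^ Suc k) \<le> norm q ^ k / (1 - norm q)"
      using q by (intro frac_le) (auto simp: norm_power simp del: power_Suc)
    then have "norm (lambert (of_nat (Suc k) * \<tau>)) \<le> norm q ^ k / (1 - norm q)"
      by (simp add: l norm_divide del: power_Suc of_nat_Suc)
    moreover have "norm (lambert (of_nat (Suc k) * \<tau>) / of_nat (Suc k)) \<le> norm (lambert (of_nat (Suc k) * \<tau>)) / 1"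
      unfolding norm_divide by (rule divide_left_mono) (auto simp del: of_nat_Suc)
    ultimately show ?thesis by simp
  qed
  have "summable (\<lambda>k. norm q ^ k / (1 - norm q))"
    using q by (intro summable_divide summable_geometric) simp
  then show ?thesis
    by (rule summable_comparison_test') (simp only: real_norm_def abs_norm_cancel, rule le)
qed

lemma lambert_series_sums:
  assumes "Im \<tau> > 0"
  shows "(\<lambda>k. lambert (of_nat (Suc k) * \<tau>) / of_nat (Suc k)) sums lambert_series \<tau>"
  unfolding lambert_series_def
  by (intro summable_sums summable_norm_cancel[OF summable_norm_lambert_series] assms)

text \<open>Expand every \<open>ln (1 - q^n)\<close> in powers of \<open>q^n\<close> and sum over
  \<open>n\<close> first: the terms of order \<open>k\<close> form a geometric series, whose value
  is the Lambert term. Principal logarithms suffice, because their sum is only used inside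
  \<open>exp\<close>.\<close>

lemma dedekind_eta_eq_exp:
  assumes "Im \<tau> > 0"
  shows "dedekind_eta \<tau> = exp (2 * of_real pi * \<i> * \<tau> / 24 - lambert_series \<tau>)"
proof -
  define q where "q = exp (2 * of_real pi * \<i> * \<tau>)"
  have q: "norm q < 1" using norm_nome_less_1[OF assms] by (simp add: q_def)
  define f where "f i j = (q ^ Suc i) ^ Suc j / of_nat (Suc j)" for i j
  have qpow: "norm (q ^ Suc i) < 1" for i
    unfolding norm_power using q by (intro power_Suc_less_one) (auto simp: q_def)
  have row: "(\<Sum>j. f i j) = - ln (1 - q ^ Suc i)" for i
  proof -
    have "(\<lambda>n. - (((q ^ Suc i) ^ n) / of_nat n)) sums ln (1 - q ^ Suc i)"
      using Ln_series'[of "- (q ^ Suc i)"] qpow[of i] by (simp del: power_Suc)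
    then have "(\<lambda>j. - f i j) sums ln (1 - q ^ Suc i)"
      unfolding f_def by (subst sums_Suc_iff) (simp del: power_Suc)
    then show ?thesis
      using sums_minus by (fastforce simp: sums_iff)
  qed
  have col: "(\<Sum>i. f i j) = lambert (of_nat (Suc j) * \<tau>) / of_nat (Suc j)" for j
  proof -
    have "(\<lambda>i. q ^ Suc j * (q ^ Suc j) ^ i / of_nat (Suc j)) sums
            (q ^ Suc j * (1 / (1 - q ^ Suc j)) / of_nat (Suc j))"
      by (intro sums_divide sums_mult geometric_sums qpow)
    moreover have "q ^ Suc j * (q ^ Suc j) ^ i / of_nat (Suc j) = f i j" for i
      unfolding f_def by (simp flip: power_mult power_add add: algebra_simps)
    ultimately show ?thesis
      unfolding lambert_def exp_nome_power q_def[symmetric] by (simp add: sums_iff)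
  qed
  have le: "norm (f i j) \<le> norm q ^ i * norm q ^ j" for i j
  proof -
    have "norm (f i j) = norm q ^ (Suc i * Suc j) / real (Suc j)"
      unfolding f_def norm_divide norm_power norm_of_nat power_mult ..
    also have "\<dots> \<le> norm q ^ (Suc i * Suc j) / 1"
      by (rule divide_left_mono) auto
    \<comment> \<open>Since \<open>(i + 1) * (j + 1) \<ge> i + j\<close>, the bound becomes a
      product of two geometric terms.\<close>
    also have "\<dots> \<le> norm q ^ (i + j)"
      unfolding div_by_1 using q by (intro power_decreasing) auto
    finally show ?thesis by (simp add: power_add)
  qed
  have "(\<lambda>i. \<Sum>j. f i j) sums (\<Sum>j. \<Sum>i. f i j)"
    using q by (intro suminf_swap_dominated[OF le]) (auto intro!: summable_geometric)
  then have "(\<lambda>i. - ln (1 - q ^ Suc i)) sums lambert_series \<tau>"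
    by (simp only: row col lambert_series_def)
  then have sums: "(\<lambda>i. ln (1 - q ^ Suc i)) sums (- lambert_series \<tau>)"
    using sums_minus by fastforce
  have "(\<Prod>i. 1 - q ^ Suc i) = (\<Prod>i. exp (ln (1 - q ^ Suc i)))"
  proof (intro arg_cong[of _ _ prodinf] ext)
    fix i show "1 - q ^ Suc i = exp (ln (1 - q ^ Suc i))"
      using qpow[of i] by (subst exp_Ln) (auto simp del: power_Suc)
  qed
  also have "\<dots> = exp (- lambert_series \<tau>)"
    using prodinf_exp[OF sums_summable[OF sums]] sums_unique[OF sums] by simp
  finally have "(\<Prod>i. 1 - q ^ Suc i) = exp (- lambert_series \<tau>)" .
  then show ?thesis
    unfolding dedekind_eta_def q_def by (simp only: diff_conv_add_uminus exp_add)
qed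

subsection \<open>Inversion of the Weber functions\<close>

text \<open>Twice the terms at even integers amounts to half of \<open>pi\<^sup>2 / 6\<close>;
  removing it from the full sum leaves the alternating one.\<close>

lemma alternating_inverse_squares_sums:
  "(\<lambda>n. (-1) ^ n / real (Suc n) ^ 2) sums (pi\<^sup>2 / 12)"
proof -
  have s: "(\<lambda>n. 1 / real (Suc n) ^ 2) sums (pi\<^sup>2 / 6)"
    using inverse_squares_sums by (simp add: add.commute)
  then have "summable (\<lambda>n. (-1) ^ n * (1 / real (Suc n) ^ 2))"
    by (intro summable_norm_cancel[OF summable_comparison_test'[OF sums_summable]]) (auto simp: abs_mult)
  then have t: "(\<lambda>n. (-1) ^ n * (1 / real (Suc n) ^ 2)) sums (\<Sum>n. (-1) ^ n * (1 / real (Suc n) ^ 2))"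
    by (rule summable_sums)
  have "(\<lambda>j. 1 / 2 * (1 / real (Suc j) ^ 2)) sums (1 / 2 * (pi\<^sup>2 / 6))"
    by (intro sums_mult s)
  also have "(\<lambda>j. 1 / 2 * (1 / real (Suc j) ^ 2)) = (\<lambda>j. 2 * (1 / real (Suc (2 * j + 1)) ^ 2))"
    by (rule ext) (simp add: divide_simps power2_eq_square, simp add: algebra_simps)
  finally have "(\<Sum>n. (-1) ^ n * (1 / real (Suc n) ^ 2)) = pi\<^sup>2 / 12"
    using sums_unique2[OF _ sums_double_even[OF s t]] by fastforce
  with t show ?thesis by (simp only: mult_1_right times_divide_eq_right)
qed

text \<open>Factor into \<open>x * \<tau> + y\<close> and \<open>x * \<tau> - y\<close>. Each factor
  is bounded below by its imaginary part, which controls \<open>x\<close>, and by the imaginary part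
  of its product with \<open>cnj \<tau>\<close>, which controls \<open>y\<close>. This gives a
  uniform quadratic bound for the denominators of the double series.\<close>

lemma norm_square_diff_ge:
  fixes \<tau> :: complex and c :: real
  assumes "Im \<tau> > 0" and c: "c = min (Im \<tau>) (Im \<tau> / norm \<tau>)" and xy: "x \<ge> 0" "y \<ge> 0"
  shows "norm (of_real x ^ 2 * \<tau> ^ 2 - of_real y ^ 2) \<ge> c ^ 2 * (max x y) ^ 2"
proof -
  have c0: "c > 0" and n0: "norm \<tau> > 0"
    using assms(1) by (auto simp: c intro!: divide_pos_pos)
  have *: "norm (of_real x * \<tau> + of_real y) \<ge> c * max x \<bar>y\<bar>" for y
  proof -
    have "c * x \<le> Im \<tau> * x" using xy by (intro mult_right_mono) (auto simp: c)
    also have "\<dots> \<le> norm (of_real x * \<tau> + of_real y)"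
      using abs_Im_le_cmod[of "of_real x * \<tau> + of_real y"] by (simp add: mult.commute)
    finally have 1: "c * x \<le> norm (of_real x * \<tau> + of_real y)" .
    have "c * \<bar>y\<bar> \<le> Im \<tau> / norm \<tau> * \<bar>y\<bar>" by (intro mult_right_mono) (auto simp: c)
    also have "Im \<tau> * \<bar>y\<bar> = \<bar>Im ((of_real x * \<tau> + of_real y) * cnj \<tau>)\<bar>"
      using assms(1) by (simp add: algebra_simps abs_mult)
    then have "Im \<tau> / norm \<tau> * \<bar>y\<bar> = \<bar>Im ((of_real x * \<tau> + of_real y) * cnj \<tau>)\<bar> / norm \<tau>"
      by simp
    also have "\<dots> \<le> norm ((of_real x * \<tau> + of_real y) * cnj \<tau>) / norm \<tau>"
      by (intro divide_right_mono abs_Im_le_cmod) auto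
    also have "\<dots> = norm (of_real x * \<tau> + of_real y)"
      using n0 by (simp add: norm_mult)
    finally have 2: "c * \<bar>y\<bar> \<le> norm (of_real x * \<tau> + of_real y)" .
    from 1 2 show ?thesis by (auto simp: max_def)
  qed
  have "c ^ 2 * (max x y) ^ 2 = (c * max x \<bar>y\<bar>) * (c * max x \<bar>- y\<bar>)"
    using xy by (simp add: power2_eq_square)
  also have "\<dots> \<le> norm (of_real x * \<tau> + of_real y) * norm (of_real x * \<tau> + of_real (- y))"
    using c0 xy by (intro mult_mono * ) auto
  also have "\<dots> = norm (of_real x ^ 2 * \<tau> ^ 2 - of_real y ^ 2)"
    by (simp add: algebra_simps power2_eq_square flip: norm_mult)
  finally show ?thesis .
qed

text \<open>
  The double series is only conditionally convergent; pairing consecutive terms of the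
  alternating sum makes it absolutely convergent.
\<close>

lemma alternating_double_series_swap:
  fixes \<tau> :: complex
  defines "h \<equiv> \<lambda>m n. 1 / (of_nat (Suc m) ^ 2 * \<tau> ^ 2 - of_nat (Suc n) ^ 2)"
  assumes \<tau>: "Im \<tau> > 0"
    and rows: "\<And>m. (\<lambda>n. h m n) sums H m" "(\<lambda>m. (-1) ^ m * H m) sums s"
    and cols: "\<And>n. (\<lambda>m. (-1) ^ m * h m n) sums K n" "K sums t"
  shows "s = t"
proof -
  define c where "c = min (Im \<tau>) (Im \<tau> / norm \<tau>)"
  have c0: "c > 0" using \<tau> by (auto simp: c_def intro!: divide_pos_pos)
  define F where "F j n = h (2 * j) n - h (2 * j + 1) n" for j n
  define C where "C = 4 * norm \<tau> ^ 2 / c ^ 4"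
  \<comment> \<open>The paired term is at most a multiple of \<open>(j + 1) / M^4\<close>, where
    \<open>M\<close> is the maximum of \<open>j + 1\<close> and \<open>n + 1\<close>. Splitting
    \<open>M^4\<close> into the powers \<open>5 / 2\<close> and \<open>3 / 2\<close> leaves the
    exponent \<open>- 3 / 2\<close> for both indices, which is summable.\<close>
  define g where "g n = real (Suc n) powr (- 3 / 2)" for n
  have g_nonneg: "g n \<ge> 0" for n by (simp add: g_def)
  have den: "c ^ 2 * (real (max (Suc m) (Suc n))) ^ 2 \<le> norm (of_nat (Suc m) ^ 2 * \<tau> ^ 2 - of_nat (Suc n) ^ 2)" for m n
    using norm_square_diff_ge[OF \<tau> c_def, of "real (Suc m)" "real (Suc n)"]
    by (simp add: of_nat_max del: of_nat_Suc)
  have le: "norm (F j n) \<le> (C * g j) * g n" for j n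
  proof -
    define M where "M = real (max (Suc j) (Suc n))"
    define d1 where "d1 = of_nat (Suc (2 * j)) ^ 2 * \<tau> ^ 2 - of_nat (Suc n) ^ 2"
    define d2 where "d2 = of_nat (Suc (2 * j + 1)) ^ 2 * \<tau> ^ 2 - of_nat (Suc n) ^ 2"
    have M: "M \<ge> 1" "M \<ge> real (Suc j)" "M \<ge> real (Suc n)" by (auto simp: M_def)
    have pos: "c ^ 2 * M ^ 2 > 0" using c0 M by simp
    have "c ^ 2 * M ^ 2 \<le> c ^ 2 * (real (max (Suc (2 * j)) (Suc n))) ^ 2"
      unfolding M_def by (intro mult_left_mono power_mono) auto
    also have "\<dots> \<le> norm d1" unfolding d1_def by (rule den)
    finally have d1: "norm d1 \<ge> c ^ 2 * M ^ 2" .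
    have "c ^ 2 * M ^ 2 \<le> c ^ 2 * (real (max (Suc (2 * j + 1)) (Suc n))) ^ 2"
      unfolding M_def by (intro mult_left_mono power_mono) auto
    also have "\<dots> \<le> norm d2" unfolding d2_def by (rule den)
    finally have d2: "norm d2 \<ge> c ^ 2 * M ^ 2" .
    have "d1 \<noteq> 0" "d2 \<noteq> 0" using d1 d2 pos by auto
    then have "F j n = (d2 - d1) / (d1 * d2)"
      unfolding F_def h_def d1_def[symmetric] d2_def[symmetric] by (simp add: divide_simps)
    \<comment> \<open>The gain from pairing: the difference of neighbouring denominators is only
      linear in \<open>j\<close>, while their product is at least of order
      \<open>M^4\<close>.\<close>
    also have "d2 - d1 = of_real (4 * real j + 3) * \<tau> ^ 2"
      unfolding d1_def d2_def by (simp add: algebra_simps power2_eq_square)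
    finally have "norm (F j n) = (4 * real j + 3) * norm \<tau> ^ 2 / (norm d1 * norm d2)"
      by (simp only: norm_divide norm_mult norm_power norm_of_real)
    also have "\<dots> \<le> (4 * real (Suc j)) * norm \<tau> ^ 2 / ((c ^ 2 * M ^ 2) * (c ^ 2 * M ^ 2))"
      using pos by (intro frac_le mult_mono d1 d2) auto
    also have "\<dots> = C * (real (Suc j) / M ^ 4)"
      by (simp add: C_def power_numeral_reduce mult_ac)
    also have "\<dots> \<le> C * (real (Suc j) powr (- 3 / 2) * real (Suc n) powr (- 3 / 2))"
    proof (rule mult_left_mono)
      have "real (Suc j) powr (5 / 2) * real (Suc n) powr (3 / 2) \<le> M powr (5 / 2) * M powr (3 / 2)"
        using M by (intro mult_mono powr_mono2) auto
      also have "\<dots> = M ^ 4"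
        using M by (simp flip: powr_add powr_numeral)
      finally have "real (Suc j) / M ^ 4 \<le> real (Suc j) / (real (Suc j) powr (5 / 2) * real (Suc n) powr (3 / 2))"
        using M by (intro divide_left_mono mult_pos_pos) (auto intro: zero_less_power)
      also have "\<dots> = real (Suc j) powr (1 - 5 / 2) * real (Suc n) powr (- (3 / 2))"
        by (simp only: powr_diff powr_minus powr_one of_nat_0_le_iff divide_inverse inverse_mult_distrib mult.assoc)
      finally show "real (Suc j) / M ^ 4 \<le> real (Suc j) powr (- 3 / 2) * real (Suc n) powr (- 3 / 2)"
        by simp
    qed (auto simp: C_def)
    finally show ?thesis by (simp add: g_def)
  qed
  have "summable g"
    unfolding g_def using summable_real_powr_iff[of "- 3 / 2"] by (subst summable_Suc_iff) simp
  then have "(\<lambda>j. \<Sum>n. F j n) sums (\<Sum>n. \<Sum>j. F j n)"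
    by (intro suminf_swap_dominated[OF le] summable_mult) (simp_all add: C_def g_nonneg)
  moreover have "(\<Sum>n. F j n) = H (2 * j) - H (2 * j + 1)" for j
    unfolding F_def by (rule sums_unique[symmetric]) (intro sums_diff rows)
  moreover have "(\<Sum>j. F j n) = K n" for n
    using sums_unique[OF sums_pair[OF cols(1)[of n]]] by (simp add: F_def)
  ultimately have "(\<lambda>j. H (2 * j) - H (2 * j + 1)) sums t"
    using sums_unique[OF cols(2)] by simp
  moreover have "(\<lambda>j. H (2 * j) - H (2 * j + 1)) sums s"
    using sums_pair[OF rows(2)] by simp
  ultimately show ?thesis by (rule sums_unique2[symmetric])
qed

lemma summable_altI:
  fixes f :: "nat \<Rightarrow> complex"
  assumes "summable (\<lambda>n. norm (f n))"
  shows "summable (\<lambda>n. (-1) ^ n * f n)"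
  using assms by (intro summable_norm_cancel[of "\<lambda>n. (-1) ^ n * f n"]) (simp add: norm_mult norm_power)

text \<open>The \<open>k\<close>-th term of the series at \<open>2 * \<tau>\<close> is twice the
  term at the even integer \<open>2 * k\<close> of the series at \<open>\<tau>\<close>.\<close>

lemma alternating_lambert_sums:
  assumes "Im \<tau> > 0"
  shows "(\<lambda>m. (-1) ^ m * (lambert (of_nat (Suc m) * \<tau>) / of_nat (Suc m))) sums
           (lambert_series \<tau> - lambert_series (2 * \<tau>))"
proof -
  let ?e = "\<lambda>m. lambert (of_nat (Suc m) * \<tau>) / of_nat (Suc m)"
  have t: "(\<lambda>m. (-1) ^ m * ?e m) sums (\<Sum>m. (-1) ^ m * ?e m)"
    by (intro summable_sums summable_altI summable_norm_lambert_series assms)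
  have "(\<lambda>j. lambert (of_nat (Suc j) * (2 * \<tau>)) / of_nat (Suc j)) sums lambert_series (2 * \<tau>)"
    using assms by (intro lambert_series_sums) simp
  moreover have "lambert (of_nat (Suc j) * (2 * \<tau>)) / of_nat (Suc j) = 2 * ?e (2 * j + 1)" for j
  proof -
    have "of_nat (Suc (2 * j + 1)) = (2 * of_nat (Suc j) :: complex)" by simp
    then have "lambert (of_nat (Suc (2 * j + 1)) * \<tau>) = lambert (of_nat (Suc j) * (2 * \<tau>))"
      "2 / of_nat (Suc (2 * j + 1)) = 1 / (of_nat (Suc j) :: complex)"
      by (simp_all only: mult.assoc mult.left_commute[of 2]) (simp del: of_nat_Suc)
    then show ?thesis by (metis mult.commute times_divide_eq_right mult_1_left)
  qed
  ultimately have "(\<lambda>j. 2 * ?e (2 * j + 1)) sums lambert_series (2 * \<tau>)"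
    by (simp only:)
  then have "lambert_series (2 * \<tau>) = lambert_series \<tau> - (\<Sum>m. (-1) ^ m * ?e m)"
    by (rule sums_unique2[OF _ sums_double_even[OF lambert_series_sums[OF assms] t]])
  with t show ?thesis by simp
qed

text \<open>This is the expansion of \<open>1 / z - pi / sin (pi * z)\<close>, obtained from
  \<open>cot (pi * z) - cot (pi * z / 2)\<close>: the terms at even integers reproduce the partial
  fractions at \<open>z / 2\<close>.\<close>

lemma lambert_alternating_partial_fractions:
  fixes z :: complex
  assumes "Im z > 0"
  shows "(\<lambda>m. (-1) ^ m * (2 * z / (z ^ 2 - of_nat (Suc m) ^ 2))) sums
           (- 2 * pi * \<i> * (lambert z - lambert (z / 2)) + 1 / z)"
proof -
  let ?g = "\<lambda>m. 2 * z / (z ^ 2 - of_nat (Suc m) ^ 2)"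
  have s: "?g sums (- 2 * pi * \<i> * (lambert z + 1 / 2) - 1 / z)"
    by (rule lambert_partial_fractions[OF assms])
  have norm: "summable (\<lambda>m. norm (?g m))"
  proof -
    define c where "c = min (Im z) (Im z / norm z)"
    have c0: "c > 0" using assms by (auto simp: c_def intro!: divide_pos_pos)
    have "norm (?g m) \<le> 2 * norm z / c ^ 2 * (1 / real (Suc m) ^ 2)" for m
    proof -
      have "c ^ 2 * real (Suc m) ^ 2 \<le> c ^ 2 * (max 1 (real (Suc m))) ^ 2"
        by (intro mult_left_mono power_mono) auto
      also have "\<dots> \<le> norm (z ^ 2 - of_nat (Suc m) ^ 2)"
        using norm_square_diff_ge[OF assms c_def, of 1 "real (Suc m)"] by (simp del: of_nat_Suc)
      finally have "norm (?g m) \<le> 2 * norm z / (c ^ 2 * real (Suc m) ^ 2)"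
        using c0 unfolding norm_divide by (intro frac_le) (auto simp: norm_mult simp del: of_nat_Suc)
      then show ?thesis by simp
    qed
    moreover have "summable (\<lambda>m. 2 * norm z / c ^ 2 * (1 / real (Suc m) ^ 2))"
      using sums_summable[OF inverse_squares_sums] by (intro summable_mult) (simp add: add.commute)
    ultimately show ?thesis
      by (intro summable_comparison_test'[of _ 0 "\<lambda>m. norm (?g m)"]) (auto simp only: real_norm_def abs_norm_cancel)
  qed
  then have t: "(\<lambda>m. (-1) ^ m * ?g m) sums (\<Sum>m. (-1) ^ m * ?g m)"
    by (intro summable_sums summable_altI)
  have "(\<lambda>n. 2 * (z / 2) / ((z / 2) ^ 2 - of_nat (Suc n) ^ 2)) sums
          (- 2 * pi * \<i> * (lambert (z / 2) + 1 / 2) - 1 / (z / 2))"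
    using assms by (intro lambert_partial_fractions) simp
  moreover have "2 * (z / 2) / ((z / 2) ^ 2 - of_nat (Suc n) ^ 2) = 2 * ?g (2 * n + 1)" for n
  proof -
    have "z ^ 2 - of_nat (Suc (2 * n + 1)) ^ 2 = 4 * ((z / 2) ^ 2 - of_nat (Suc n) ^ 2)"
      by (simp add: power2_eq_square algebra_simps)
    moreover have "2 * (z / 2) / w = 2 * (2 * z / (4 * w))" for w by simp
    ultimately show ?thesis by (simp only:)
  qed
  ultimately have "(\<lambda>n. 2 * ?g (2 * n + 1)) sums (- 2 * pi * \<i> * (lambert (z / 2) + 1 / 2) - 1 / (z / 2))"
    by (simp only:)
  then have "- 2 * pi * \<i> * (lambert (z / 2) + 1 / 2) - 1 / (z / 2)
      = - 2 * pi * \<i> * (lambert z + 1 / 2) - 1 / z - (\<Sum>m. (-1) ^ m * ?g m)"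
    by (rule sums_unique2[OF _ sums_double_even[OF s t]])
  then have "(\<Sum>m. (-1) ^ m * ?g m) = - 2 * pi * \<i> * (lambert z - lambert (z / 2)) + 1 / z"
    by (simp add: algebra_simps)
  with t show ?thesis by simp
qed

text \<open>Summing the double series over \<open>n\<close> first yields Lambert terms at
  \<open>\<tau>\<close>; summing over \<open>m\<close> first yields those at \<open>\<sigma>\<close>
  and \<open>\<sigma> / 2\<close>. Equality of the two totals is the logarithmic form of the claim,
  with the elementary terms providing the factor \<open>sqrt 2\<close> and the exponential
  prefactors of eta.\<close>

theorem weber_f1_S:
  assumes \<tau>: "Im \<tau> > 0"
  shows "weber_f1 (- 1 / \<tau>) = weber_f2 \<tau>"
proof -
  define \<sigma> where "\<sigma> = - 1 / \<tau>"
  have \<tau>0: "\<tau> \<noteq> 0" using \<tau> by auto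
  have \<sigma>: "Im \<sigma> > 0"
    using \<tau> \<tau>0 by (simp add: \<sigma>_def Im_divide cmod_power2 divide_simps sum_power2_gt_zero_iff)
  define h where "h m n = 1 / (of_nat (Suc m) ^ 2 * \<tau> ^ 2 - of_nat (Suc n) ^ 2)" for m n
  define H where "H m = (- 2 * pi * \<i> * (lambert (of_nat (Suc m) * \<tau>) + 1 / 2)
                     - 1 / (of_nat (Suc m) * \<tau>)) / (2 * (of_nat (Suc m) * \<tau>))" for m
  define K where "K n = (- 2 * pi * \<i> * (lambert (of_nat (Suc n) * \<sigma>) - lambert (of_nat (Suc n) * \<sigma> / 2))
                     + 1 / (of_nat (Suc n) * \<sigma>)) / (2 * of_nat (Suc n) * \<tau>)" for n
  define L where "L = lambert_series \<tau> - lambert_series (2 * \<tau>)"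
  define L' where "L' = lambert_series \<sigma> - lambert_series (\<sigma> / 2)"
  have rows: "(\<lambda>n. h m n) sums H m" for m
  proof -
    have nz: "of_nat (Suc m) * \<tau> \<noteq> 0" using \<tau>0 by (simp del: of_nat_Suc)
    have "0 < Im (of_nat (Suc m) * \<tau>)" using \<tau> by (simp del: of_nat_Suc)
    from sums_divide[OF lambert_partial_fractions[OF this], of "2 * (of_nat (Suc m) * \<tau>)"]
    show ?thesis
      using nz unfolding H_def h_def by (simp add: power_mult_distrib del: of_nat_Suc)
  qed
  have cols: "(\<lambda>m. (-1) ^ m * h m n) sums K n" for n
  proof -
    have "0 < Im (of_nat (Suc n) * \<sigma>)" using \<sigma> by (simp del: of_nat_Suc)
    from sums_divide[OF lambert_alternating_partial_fractions[OF this], of "2 * of_nat (Suc n) * \<tau>"]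
    have "(\<lambda>m. (-1) ^ m * (2 * (of_nat (Suc n) * \<sigma>) / ((of_nat (Suc n) * \<sigma>) ^ 2 - of_nat (Suc m) ^ 2)) /
            (2 * of_nat (Suc n) * \<tau>)) sums K n"
      unfolding K_def .
    moreover have "(-1) ^ m * (2 * (of_nat (Suc n) * \<sigma>) / ((of_nat (Suc n) * \<sigma>) ^ 2 - of_nat (Suc m) ^ 2)) /
            (2 * of_nat (Suc n) * \<tau>) = (-1) ^ m * h m n" for m
    proof -
      define N where "N = (of_nat (Suc n) :: complex)"
      define M where "M = (of_nat (Suc m) :: complex)"
      have N0: "N \<noteq> 0" unfolding N_def by (simp del: of_nat_Suc)
      define d where "d = M ^ 2 * \<tau> ^ 2 - N ^ 2"
      \<comment> \<open>As \<open>\<sigma> = - 1 / \<tau>\<close>, column \<open>n\<close> of the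
        double series is, up to a factor, the alternating expansion at
        \<open>N * \<sigma>\<close>.\<close>
      have "(N * \<sigma>) ^ 2 - M ^ 2 = - d / \<tau> ^ 2"
        using \<tau>0 by (simp add: \<sigma>_def d_def field_simps)
      then have "2 * (N * \<sigma>) / ((N * \<sigma>) ^ 2 - M ^ 2) / (2 * N * \<tau>) = 1 / d"
        using \<tau>0 N0 by (simp add: \<sigma>_def power2_eq_square)
      then show ?thesis
        unfolding h_def d_def N_def M_def by (simp only: times_divide_eq_right[symmetric])
    qed
    ultimately show ?thesis by (simp only:)
  qed
  \<comment> \<open>The three parts of \<open>H m\<close>: the Lambert part, the summand
    \<open>1 / 2\<close>, which turns into \<open>ln 2\<close> by the alternating harmonic series,
    and the term from \<open>1 / z\<close>, which turns into \<open>pi\<^sup>2 / 12\<close>.\<close>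
  have "(\<lambda>m. - (pi * \<i> / \<tau>) * ((-1) ^ m * (lambert (of_nat (Suc m) * \<tau>) / of_nat (Suc m)))
            - pi * \<i> / (2 * \<tau>) * of_real ((-1) ^ m / real (Suc m))
            - 1 / (2 * \<tau> ^ 2) * of_real ((-1) ^ m / real (Suc m) ^ 2))
          sums (- (pi * \<i> / \<tau>) * L - pi * \<i> / (2 * \<tau>) * of_real (ln 2) - 1 / (2 * \<tau> ^ 2) * of_real (pi\<^sup>2 / 12))"
    unfolding L_def
    by (intro sums_diff sums_mult sums_of_real alternating_lambert_sums \<tau>
          alternating_harmonic_series_sums alternating_inverse_squares_sums)
  moreover have "- (pi * \<i> / \<tau>) * ((-1) ^ m * (lambert (of_nat (Suc m) * \<tau>) / of_nat (Suc m)))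
            - pi * \<i> / (2 * \<tau>) * of_real ((-1) ^ m / real (Suc m))
            - 1 / (2 * \<tau> ^ 2) * of_real ((-1) ^ m / real (Suc m) ^ 2) = (-1) ^ m * H m" for m
  proof -
    define M where "M = (of_nat (Suc m) :: complex)"
    have M0: "M \<noteq> 0" unfolding M_def by (simp del: of_nat_Suc)
    have "- (pi * \<i> / \<tau>) * (e * (l / M)) - pi * \<i> / (2 * \<tau>) * (e / M) - 1 / (2 * \<tau> ^ 2) * (e / M ^ 2)
        = e * ((- 2 * pi * \<i> * (l + 1 / 2) - 1 / (M * \<tau>)) / (2 * (M * \<tau>)))" for e l
      using \<tau>0 M0 by (simp add: divide_simps power2_eq_square) (simp add: algebra_simps)
    then show ?thesis
      unfolding H_def M_def by (simp del: of_nat_Suc)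
  qed
  ultimately have s: "(\<lambda>m. (-1) ^ m * H m) sums (- (pi * \<i> / \<tau>) * L - pi * \<i> / (2 * \<tau>) * of_real (ln 2)
                     - 1 / (2 * \<tau> ^ 2) * of_real (pi\<^sup>2 / 12))"
    by (simp only:)
  have "(\<lambda>n. - (pi * \<i> / \<tau>) * (lambert (of_nat (Suc n) * \<sigma>) / of_nat (Suc n)
                   - lambert (of_nat (Suc n) * (\<sigma> / 2)) / of_nat (Suc n))
            - 1 / 2 * of_real (1 / real (Suc n) ^ 2))
          sums (- (pi * \<i> / \<tau>) * L' - 1 / 2 * of_real (pi\<^sup>2 / 6))"
    using \<sigma> inverse_squares_sums unfolding L'_def
    by (intro sums_diff sums_mult sums_of_real lambert_series_sums) (auto simp: add.commute)
  moreover have "- (pi * \<i> / \<tau>) * (lambert (of_nat (Suc n) * \<sigma>) / of_nat (Suc n)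
                   - lambert (of_nat (Suc n) * (\<sigma> / 2)) / of_nat (Suc n))
            - 1 / 2 * of_real (1 / real (Suc n) ^ 2) = K n" for n
  proof -
    define N where "N = (of_nat (Suc n) :: complex)"
    have N0: "N \<noteq> 0" unfolding N_def by (simp del: of_nat_Suc)
    have "- (pi * \<i> / \<tau>) * (l / N - l' / N) - 1 / 2 * (1 / N ^ 2)
        = (- 2 * pi * \<i> * (l - l') + 1 / (N * \<sigma>)) / (2 * N * \<tau>)" for l l'
      using \<tau>0 N0 by (simp add: \<sigma>_def divide_simps power2_eq_square)
    then show ?thesis
      unfolding K_def N_def by (simp del: of_nat_Suc)
  qed
  ultimately have t: "K sums (- (pi * \<i> / \<tau>) * L' - 1 / 2 * of_real (pi\<^sup>2 / 6))"
    by (simp only:)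
  have "- (pi * \<i> / \<tau>) * L - pi * \<i> / (2 * \<tau>) * of_real (ln 2) - 1 / (2 * \<tau> ^ 2) * of_real (pi\<^sup>2 / 12)
      = - (pi * \<i> / \<tau>) * L' - 1 / 2 * of_real (pi\<^sup>2 / 6)"
    by (rule alternating_double_series_swap[OF \<tau> rows[unfolded h_def] s cols[unfolded h_def] t])
  \<comment> \<open>The factor normalises the coefficients of \<open>L\<close> and \<open>L'\<close>
    to 1.\<close>
  then have "(\<i> * \<tau> / pi) * (- (pi * \<i> / \<tau>) * L - pi * \<i> / (2 * \<tau>) * of_real (ln 2) - 1 / (2 * \<tau> ^ 2) * of_real (pi\<^sup>2 / 12))
      = (\<i> * \<tau> / pi) * (- (pi * \<i> / \<tau>) * L' - 1 / 2 * of_real (pi\<^sup>2 / 6))"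
    by simp
  also have "(\<i> * \<tau> / pi) * (- (pi * \<i> / \<tau>) * L' - 1 / 2 * of_real (pi\<^sup>2 / 6)) = L' - pi * \<i> * \<tau> / 12"
    using \<tau>0 by (simp add: divide_simps power2_eq_square) (simp add: algebra_simps)
  also have "(\<i> * \<tau> / pi) * (- (pi * \<i> / \<tau>) * L - pi * \<i> / (2 * \<tau>) * of_real (ln 2) - 1 / (2 * \<tau> ^ 2) * of_real (pi\<^sup>2 / 12))
      = L + of_real (ln 2) / 2 - pi * \<i> / (24 * \<tau>)"
    using \<tau>0 by (simp add: divide_simps power2_eq_square) (simp add: algebra_simps)
  finally have key: "L' = L + of_real (ln 2) / 2 - pi * \<i> / (24 * \<tau>) + pi * \<i> * \<tau> / 12"
    by (simp add: algebra_simps)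
  have "weber_f1 \<sigma> = exp (2 * pi * \<i> * (\<sigma> / 2) / 24 - lambert_series (\<sigma> / 2) - (2 * pi * \<i> * \<sigma> / 24 - lambert_series \<sigma>))"
    unfolding weber_f1_def exp_diff[symmetric] using \<sigma>
    by (subst (1 2) dedekind_eta_eq_exp) (simp_all only: exp_diff, simp_all)
  also have "2 * pi * \<i> * (\<sigma> / 2) / 24 - lambert_series (\<sigma> / 2) - (2 * pi * \<i> * \<sigma> / 24 - lambert_series \<sigma>)
      = L' + pi * \<i> / (24 * \<tau>)"
    using \<tau>0 by (simp add: L'_def \<sigma>_def field_simps)
  also have "\<dots> = of_real (ln 2 / 2) + (2 * pi * \<i> * (2 * \<tau>) / 24 - lambert_series (2 * \<tau>) - (2 * pi * \<i> * \<tau> / 24 - lambert_series \<tau>))"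
    unfolding key by (simp add: L_def field_simps)
  also have "exp \<dots> = of_real (exp (ln 2 / 2)) * (exp (2 * pi * \<i> * (2 * \<tau>) / 24 - lambert_series (2 * \<tau>)) / exp (2 * pi * \<i> * \<tau> / 24 - lambert_series \<tau>))"
    by (simp only: exp_add exp_diff[of "2 * pi * \<i> * (2 * \<tau>) / 24 - lambert_series (2 * \<tau>)"] exp_of_real)
  also have "exp (ln 2 / 2) = sqrt 2"
    by (simp add: powr_half_sqrt[symmetric] powr_def)
  also have "of_real (sqrt 2) * (exp (2 * pi * \<i> * (2 * \<tau>) / 24 - lambert_series (2 * \<tau>)) / exp (2 * pi * \<i> * \<tau> / 24 - lambert_series \<tau>)) = weber_f2 \<tau>"
    unfolding weber_f2_def using \<tau> by (subst (1 2) dedekind_eta_eq_exp) simp_all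
  finally show ?thesis unfolding \<sigma>_def .
qed

subsection \<open>Action of the modular group\<close>

text \<open>The entries are kept as four integers because the descent and the congruences work on
  them; matrices return only for the group theory.\<close>

definition moebius :: "int \<Rightarrow> int \<Rightarrow> int \<Rightarrow> int \<Rightarrow> complex \<Rightarrow> complex" where
  "moebius a b c d \<tau> = (of_int a * \<tau> + of_int b) / (of_int c * \<tau> + of_int d)"

lemma moebius_denominator_nonzero:
  assumes "a * d - b * c = 1" "Im \<tau> > 0"
  shows "of_int c * \<tau> + of_int d \<noteq> 0"
proof
  assume eq: "of_int c * \<tau> + of_int d = 0"
  then have "Im (of_int c * \<tau> + of_int d) = 0" by simp
  then have "c = 0" using assms(2) by simp
  with eq assms(1) show False by simp
qed

lemma Im_moebius_pos:
  assumes "a * d - b * c = 1" "Im \<tau> > 0"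
  shows "Im (moebius a b c d \<tau>) > 0"
proof -
  define z where "z = of_int c * \<tau> + of_int d"
  have z: "norm z > 0" using moebius_denominator_nonzero[OF assms] by (simp add: z_def)
  have "Im (moebius a b c d \<tau>) = Im ((of_int a * \<tau> + of_int b) * cnj z) / norm z ^ 2"
    unfolding moebius_def z_def[symmetric] by (subst complex_div_cnj) (simp add: Im_divide_of_real flip: of_real_power)
  also have "Im ((of_int a * \<tau> + of_int b) * cnj z) = of_int (a * d - b * c) * Im \<tau>"
    by (simp add: z_def algebra_simps)
  finally show ?thesis using assms z by simp
qed

lemma moebius_compose:
  assumes "a' * d' - b' * c' = 1" "Im \<tau> > 0"
  shows "moebius a b c d (moebius a' b' c' d' \<tau>)
      = moebius (a * a' + b * c') (a * b' + b * d') (c * a' + d * c') (c * b' + d * d') \<tau>"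
proof -
  define z where "z = of_int c' * \<tau> + of_int d'"
  have z: "z \<noteq> 0" using moebius_denominator_nonzero[OF assms] by (simp add: z_def)
  define x where "x = of_int a' * \<tau> + of_int b'"
  have e: "p * (x / z) + q = (p * x + q * z) / z" for p q
    using z by (simp add: field_simps)
  have "moebius a b c d (moebius a' b' c' d' \<tau>)
      = ((of_int a * x + of_int b * z) / z) / ((of_int c * x + of_int d * z) / z)"
    unfolding moebius_def z_def[symmetric] x_def[symmetric] e ..
  also have "\<dots> = (of_int a * x + of_int b * z) / (of_int c * x + of_int d * z)"
    using z by simp
  also have "\<dots> = moebius (a * a' + b * c') (a * b' + b * d') (c * a' + d * c') (c * b' + d * d') \<tau>"
    unfolding moebius_def z_def x_def by (rule arg_cong2[of _ _ _ _ "(/)"]) (simp_all add: algebra_simps)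
  finally show ?thesis .
qed

section \<open>Cubes of the Weber functions under translation and inversion\<close>

lemma zeta_root_nonzero [simp]: "zeta_root k \<noteq> 0"
  by (simp add: zeta_root_def)

abbreviation zeta16 :: complex where "zeta16 \<equiv> zeta_root 16"

lemma zeta16_powi: "zeta16 powi n = exp (2 * of_real pi * \<i> * of_int n / 16)"
  unfolding zeta_root_def exp_power_int by (simp add: mult_ac)

lemma zeta16_powi_eq_1_iff: "zeta16 powi n = 1 \<longleftrightarrow> 16 dvd n"
proof
  assume "zeta16 powi n = 1"
  then obtain m :: int where "2 * pi * real_of_int n / 16 = of_int (2 * m) * pi"
    unfolding zeta16_powi exp_eq_1 by auto
  then have "real_of_int n = of_int (16 * m)" by (simp add: field_simps)
  then show "16 dvd n" by (simp only: of_int_eq_iff) simp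
next
  assume "16 dvd n"
  then obtain m where "n = 16 * m" by auto
  then show "zeta16 powi n = 1"
    unfolding zeta16_powi exp_eq_1 by (auto intro!: exI[of _ m])
qed

lemma zeta16_powi_cong: "[m = n] (mod 16) \<Longrightarrow> zeta16 powi m = zeta16 powi n"
  using zeta16_powi_eq_1_iff[of "m - n"]
  by (simp add: cong_iff_dvd_diff power_int_diff)

lemma dedekind_eta_nonzero: "Im \<tau> > 0 \<Longrightarrow> dedekind_eta \<tau> \<noteq> 0"
  by (simp add: dedekind_eta_eq_exp)

lemma dedekind_eta_plus_1: "dedekind_eta (\<tau> + 1) = zeta_root 24 * dedekind_eta \<tau>"
proof -
  have "exp (2 * of_real pi * \<i> * (\<tau> + 1)) = exp (2 * of_real pi * \<i> * \<tau>)"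
    by (simp add: ring_distribs exp_add)
  moreover have "exp (2 * of_real pi * \<i> * (\<tau> + 1) / 24) = zeta_root 24 * exp (2 * of_real pi * \<i> * \<tau> / 24)"
    by (simp add: zeta_root_def ring_distribs add_divide_distrib flip: exp_add) (simp add: add.commute)
  ultimately show ?thesis unfolding dedekind_eta_def by simp
qed

lemma zeta_root_powers:
  "zeta_root 24 ^ 3 = zeta16 ^ 2" "zeta_root 48 ^ 3 = zeta16" "zeta_root 24 = zeta_root 48 ^ 2"
  by (simp_all add: zeta_root_def flip: exp_of_nat_mult)

abbreviation weber_cube :: "nat \<Rightarrow> complex \<Rightarrow> complex" where
  "weber_cube i \<tau> \<equiv> weber_u i \<tau> ^ 3"

lemma weber_f1_plus_1: "weber_f1 (\<tau> + 1) = inverse (zeta_root 48) * weber_f \<tau>"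
  unfolding weber_f1_def weber_f_def dedekind_eta_plus_1 zeta_root_powers
  by (simp add: field_simps power2_eq_square)

lemma weber_f_plus_1: "weber_f (\<tau> + 1) = inverse (zeta_root 48) * weber_f1 \<tau>"
proof -
  have "(\<tau> + 1 + 1) / 2 = \<tau> / 2 + 1" by (simp add: add_divide_distrib)
  then show ?thesis
    unfolding weber_f1_def weber_f_def by (simp only: dedekind_eta_plus_1) simp
qed

lemma weber_f2_plus_1: "weber_f2 (\<tau> + 1) = zeta_root 24 * weber_f2 \<tau>"
proof -
  have "dedekind_eta (2 * (\<tau> + 1)) = zeta_root 24 * (zeta_root 24 * dedekind_eta (2 * \<tau>))"
    using dedekind_eta_plus_1[of "2 * \<tau> + 1"] dedekind_eta_plus_1[of "2 * \<tau>"]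
    by (simp add: algebra_simps)
  then show ?thesis
    unfolding weber_f2_def by (simp add: dedekind_eta_plus_1)
qed

lemma weber_cube_simps:
  "weber_cube 0 \<tau> = weber_f \<tau> ^ 3"
  "weber_cube 1 \<tau> = zeta16 ^ 3 * weber_f1 \<tau> ^ 3"
  "weber_cube 2 \<tau> = inverse (zeta16 ^ 3) * weber_f2 \<tau> ^ 3"
  by (simp_all add: weber_u_def power_mult_distrib power_inverse)

lemma weber_cube_2_nonzero: "Im \<tau> > 0 \<Longrightarrow> weber_cube 2 \<tau> \<noteq> 0"
  by (simp add: weber_u_def weber_f2_def dedekind_eta_nonzero)

lemma weber_cube_1_plus_1: "weber_cube 1 (\<tau> + 1) = zeta16 ^ 2 * weber_cube 0 \<tau>"
  unfolding weber_cube_simps weber_f1_plus_1 power_mult_distrib power_inverse zeta_root_powers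
  by (simp add: field_simps power_numeral_reduce)

lemma weber_cube_0_plus_1: "weber_cube 0 (\<tau> + 1) = inverse (zeta16 ^ 4) * weber_cube 1 \<tau>"
  unfolding weber_cube_simps weber_f_plus_1 power_mult_distrib power_inverse zeta_root_powers
  by (simp add: field_simps power_numeral_reduce)

lemma weber_cube_2_plus_1: "weber_cube 2 (\<tau> + 1) = zeta16 ^ 2 * weber_cube 2 \<tau>"
  unfolding weber_cube_simps weber_f2_plus_1 power_mult_distrib zeta_root_powers(1)
  by (simp add: field_simps power_numeral_reduce)

lemma Im_minus_inverse_pos: "Im \<tau> > 0 \<Longrightarrow> Im (- 1 / \<tau>) > 0"
  using Im_moebius_pos[of 0 0 "-1" 1 \<tau>] by (simp add: moebius_def)

lemma weber_f2_S:
  assumes "Im \<tau> > 0"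
  shows "weber_f2 (- 1 / \<tau>) = weber_f1 \<tau>"
  using weber_f1_S[OF Im_minus_inverse_pos[OF assms]] by simp

lemma weber_cube_1_S: "Im \<tau> > 0 \<Longrightarrow> weber_cube 1 (- 1 / \<tau>) = zeta16 ^ 6 * weber_cube 2 \<tau>"
  by (simp only: weber_cube_simps weber_f1_S) (simp add: field_simps power_numeral_reduce)

lemma weber_cube_2_S: "Im \<tau> > 0 \<Longrightarrow> weber_cube 2 (- 1 / \<tau>) = inverse (zeta16 ^ 6) * weber_cube 1 \<tau>"
  by (simp only: weber_cube_simps weber_f2_S) (simp add: field_simps power_numeral_reduce)

text \<open>Unit translation exchanges the functions of index 0 and 1 up to constants, so two of
  them return to index 1.\<close>

lemma weber_cube_1_plus_2: "weber_cube 1 (\<tau> + 2) = inverse (zeta16 ^ 2) * weber_cube 1 \<tau>"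
  using weber_cube_1_plus_1[of "\<tau> + 1"] weber_cube_0_plus_1[of \<tau>]
  by (simp add: field_simps power_numeral_reduce)

text \<open>The map is translation by \<open>- 2\<close> conjugated by
  \<open>\<tau> \<mapsto> - 1 / \<tau>\<close>, and that translation multiplies
  \<open>weber_cube 1\<close> by \<open>zeta16 ^ 2\<close>.\<close>

lemma weber_cube_2_lower:
  assumes "Im \<tau> > 0"
  shows "weber_cube 2 (\<tau> / (2 * \<tau> + 1)) = zeta16 ^ 2 * weber_cube 2 \<tau>"
proof -
  define \<rho> where "\<rho> = - 1 / \<tau> - 2"
  have \<rho>: "Im \<rho> > 0"
    unfolding \<rho>_def using Im_minus_inverse_pos[OF assms] by simp
  have "\<tau> \<noteq> 0" using assms by auto
  then have "\<rho> = - ((2 * \<tau> + 1) / \<tau>)" by (simp add: \<rho>_def field_simps)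
  moreover have "- 1 / (- (y / \<tau>)) = \<tau> / y" for y by simp
  ultimately have "- 1 / \<rho> = \<tau> / (2 * \<tau> + 1)" by (simp only:)
  then have "weber_cube 2 (\<tau> / (2 * \<tau> + 1)) = inverse (zeta16 ^ 6) * weber_cube 1 \<rho>"
    using weber_cube_2_S[OF \<rho>] by simp
  also have "weber_cube 1 \<rho> = zeta16 ^ 2 * weber_cube 1 (- 1 / \<tau>)"
    using weber_cube_1_plus_2[of \<rho>] by (simp add: \<rho>_def)
  also have "\<dots> = zeta16 ^ 2 * (zeta16 ^ 6 * weber_cube 2 \<tau>)"
    using weber_cube_1_S[OF assms] by simp
  also have "inverse (zeta16 ^ 6) * (zeta16 ^ 2 * (zeta16 ^ 6 * w)) = zeta16 ^ 2 * w" for w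
    by (simp add: field_simps power_numeral_reduce)
  finally show ?thesis .
qed

section \<open>The character by which matrices with even lower left entry act on
  \<open>weber_cube 2\<close>\<close>

lemma odd_square_eq:
  fixes a :: int
  assumes "odd a"
  obtains s where "a ^ 2 = 8 * s + 1"
proof -
  from assms obtain m where m: "a = 2 * m + 1" by (elim oddE)
  have "even (m * (m + 1))" by simp
  then obtain s where "m * (m + 1) = 2 * s" by (elim evenE)
  then have "a ^ 2 = 8 * s + 1"
    by (simp add: m power2_eq_square algebra_simps)
  then show ?thesis by (rule that)
qed

lemma odd_diagonal:
  fixes a b c d :: int
  assumes "a * d - b * c = 1" "even c"
  shows "odd a" "odd d"
proof -
  have "a * d = b * c + 1"
    using assms(1) by simp
  then have "odd (a * d)"
    using assms(2) by simp
  then show "odd a" "odd d" by auto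
qed

text \<open>
  For \<open>c\<close> even, \<open>(a, b, c) \<mapsto> weber_exponent a b c / 2\<close> modulo 8 is the character of \<open>\<Gamma>\<^sub>0(2)\<close> that
  takes the value 1 on the two generators \<open>\<tau> \<mapsto> \<tau> + 1\<close> and \<open>\<tau> \<mapsto> \<tau> / (2\<tau> + 1)\<close>.
\<close>

definition weber_exponent :: "int \<Rightarrow> int \<Rightarrow> int \<Rightarrow> int" where
  "weber_exponent a b c = 2 * a * b + a * c + a ^ 2 - 1"

lemma weber_exponent_T:
  assumes "a * d - b * c = 1" "even c"
  shows "[weber_exponent (a + c) (b + d) c = weber_exponent a b c + 2] (mod 16)"
proof -
  from assms(2) obtain k where k: "c = 2 * k" by (elim evenE)
  from odd_diagonal[OF assms] obtain m n where m: "a = 2 * m + 1" and n: "d = 2 * n + 1"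
    by (elim oddE)
  \<comment> \<open>The determinant condition in terms of \<open>k\<close>, \<open>m\<close>,
    \<open>n\<close>; it is what later fixes the parity of \<open>m + n\<close>.\<close>
  have "2 * (b * k) = 2 * (2 * m * n + m + n)"
    using assms(1) unfolding k m n by (simp add: algebra_simps)
  then have bk: "b * k = 2 * m * n + m + n" by simp
  have "weber_exponent (a + c) (b + d) c - (weber_exponent a b c + 2)
      = 2 * (a * d - b * c - 1) + 4 * b * c + 2 * c * d + 2 * c ^ 2 + 2 * a * c"
    by (simp add: weber_exponent_def power2_eq_square algebra_simps)
  also have "\<dots> = 8 * (b * k + k * (m + n) + k * (k + 1))"
    unfolding assms(1) unfolding k m n by (simp add: power2_eq_square algebra_simps)
  also have "\<dots> = 8 * (2 * m * n + (m + n) * (k + 1) + k * (k + 1))"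
    unfolding bk by (simp add: algebra_simps)
  finally have eq: "weber_exponent (a + c) (b + d) c - (weber_exponent a b c + 2)
      = 8 * (2 * m * n + (m + n) * (k + 1) + k * (k + 1))" .
  have "even (2 * m * n + (m + n) * (k + 1) + k * (k + 1))"
  \<comment> \<open>Only \<open>(m + n) * (k + 1)\<close> is in doubt. If \<open>k\<close> is odd,
    \<open>k + 1\<close> is even; if \<open>k\<close> is even, then
    \<open>b * k = 2 * m * n + m + n\<close> forces \<open>m + n\<close> to be even.\<close>
  proof (cases "even k")
    case True
    then have "even (b * k)" by simp
    then have "even (m + n)" unfolding bk by simp
    with True show ?thesis by simp
  qed simp
  then obtain r where "2 * m * n + (m + n) * (k + 1) + k * (k + 1) = 2 * r"
    by (elim evenE)
  then show ?thesis
    unfolding cong_iff_dvd_diff eq by simp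
qed

text \<open>The two sides differ by \<open>2 * (a ^ 2 - 1)\<close>, and the square of an odd number
  is 1 modulo 8.\<close>

lemma weber_exponent_L:
  assumes "odd a"
  shows "[weber_exponent a b (c + 2 * a) = weber_exponent a b c + 2] (mod 16)"
proof -
  obtain s where s: "a ^ 2 = 8 * s + 1" by (rule odd_square_eq[OF assms])
  have "weber_exponent a b (c + 2 * a) - (weber_exponent a b c + 2) = 2 * (a ^ 2 - 1)"
    by (simp add: weber_exponent_def power2_eq_square algebra_simps)
  then show ?thesis unfolding cong_iff_dvd_diff s by simp
qed

definition weber_2_law :: "int \<Rightarrow> int \<Rightarrow> int \<Rightarrow> int \<Rightarrow> bool" where
  "weber_2_law a b c d \<longleftrightarrow> (\<forall>\<tau>. Im \<tau> > 0 \<longrightarrow>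
     weber_cube 2 (moebius a b c d \<tau>) = zeta16 powi weber_exponent a b c * weber_cube 2 \<tau>)"

lemma zeta16_powi_add_2:
  assumes "[m = n + 2] (mod 16)"
  shows "zeta16 powi m = zeta16 ^ 2 * zeta16 powi n"
  using zeta16_powi_cong[OF assms] by (simp add: power_int_add)

text \<open>Left multiplication by the translation matrix changes both sides of the law by the
  factor \<open>zeta16 ^ 2\<close>. The equivalence lets the descent both add and subtract
  rows.\<close>

lemma weber_2_law_T:
  assumes "a * d - b * c = 1" "even c"
  shows "weber_2_law (a + c) (b + d) c d \<longleftrightarrow> weber_2_law a b c d"
proof -
  have "weber_cube 2 (moebius (a + c) (b + d) c d \<tau>) = zeta16 ^ 2 * weber_cube 2 (moebius a b c d \<tau>)"
    if "Im \<tau> > 0" for \<tau>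
  proof -
    have "moebius (a + c) (b + d) c d \<tau> = moebius 1 1 0 1 (moebius a b c d \<tau>)"
      by (subst moebius_compose[OF assms(1) that]) simp
    also have "\<dots> = moebius a b c d \<tau> + 1" by (simp add: moebius_def)
    finally show ?thesis by (simp only: weber_cube_2_plus_1)
  qed
  then show ?thesis
    using zeta16_powi_add_2[OF weber_exponent_T[OF assms]]
    by (simp add: weber_2_law_def)
qed

lemma weber_2_law_L:
  assumes "a * d - b * c = 1" "even c"
  shows "weber_2_law a b (c + 2 * a) (d + 2 * b) \<longleftrightarrow> weber_2_law a b c d"
proof -
  have "weber_cube 2 (moebius a b (c + 2 * a) (d + 2 * b) \<tau>) = zeta16 ^ 2 * weber_cube 2 (moebius a b c d \<tau>)"
    if "Im \<tau> > 0" for \<tau>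
  proof -
    have "moebius a b (c + 2 * a) (d + 2 * b) \<tau> = moebius 1 0 2 1 (moebius a b c d \<tau>)"
      by (subst moebius_compose[OF assms(1) that]) (simp add: add.commute)
    also have "\<dots> = moebius a b c d \<tau> / (2 * moebius a b c d \<tau> + 1)"
      by (simp add: moebius_def[of 1 0 2 1])
    finally show ?thesis
      by (simp only: weber_cube_2_lower[OF Im_moebius_pos[OF assms(1) that]])
  qed
  then show ?thesis
    using zeta16_powi_add_2[OF weber_exponent_L[OF odd_diagonal(1)[OF assms], of b c]]
    by (simp add: weber_2_law_def)
qed

lemma weber_cube_2_plus_int:
  "weber_cube 2 (\<tau> + of_int n) = zeta16 powi (2 * n) * weber_cube 2 \<tau>"
proof (induction n rule: int_induct[where k = 0])
  case (step1 i)
  then show ?case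
    using weber_cube_2_plus_1[of "\<tau> + of_int i"] by (simp add: add.assoc power_int_add algebra_simps)
next
  case (step2 i)
  then show ?case
    using weber_cube_2_plus_1[of "\<tau> + of_int (i - 1)"] by (simp add: power_int_diff power_int_add algebra_simps)
qed simp

text \<open>Since \<open>a\<close> is odd and \<open>c\<close> even, their absolute values differ.
  If \<open>c\<close> is nonzero and the smaller one, adding or subtracting it shrinks
  \<open>a\<close>; if \<open>a\<close> is the smaller one, adding or subtracting
  \<open>2 * a\<close> shrinks \<open>c\<close>. The descent ends at \<open>c = 0\<close>.\<close>

theorem weber_2_law_even:
  assumes "a * d - b * c = 1" "even c"
  shows "weber_2_law a b c d"
  using assms
proof (induction "nat (\<bar>a\<bar> + \<bar>c\<bar>)" arbitrary: a b c d rule: less_induct)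
  case less
  note det = less.prems(1) and c = less.prems(2)
  have a: "odd a" by (rule odd_diagonal(1)[OF det c])
  consider "c = 0" | "c \<noteq> 0" "\<bar>c\<bar> < \<bar>a\<bar>" "a * c > 0" | "c \<noteq> 0" "\<bar>c\<bar> < \<bar>a\<bar>" "a * c < 0"
    | "\<bar>a\<bar> < \<bar>c\<bar>" "a * c > 0" | "\<bar>a\<bar> < \<bar>c\<bar>" "a * c < 0"
  proof -
    have "\<bar>a\<bar> \<noteq> \<bar>c\<bar>" using a c by (auto simp: abs_eq_iff)
    moreover have "a \<noteq> 0" using a by auto
    ultimately show ?thesis using that by (cases "c = 0") (auto simp: neq_iff mult_less_0_iff zero_less_mult_iff)
  qed
  then show ?case
  proof cases
    case 1
    then have "a * d = 1" using det by simp
    then have ad: "a = 1 \<and> d = 1 \<or> a = -1 \<and> d = -1" by (rule zmult_eq_1_iff[THEN iffD1])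
    \<comment> \<open>Here \<open>a = d\<close> is a sign, so \<open>b / d = a * b\<close>.\<close>
    have "moebius a b c d \<tau> = \<tau> + of_int (a * b)" for \<tau>
      using ad by (auto simp: moebius_def 1)
    moreover have "weber_exponent a b c = 2 * (a * b)"
      using ad by (auto simp: weber_exponent_def 1)
    ultimately show ?thesis
      by (simp only: weber_2_law_def weber_cube_2_plus_int) simp
  next
    case 2
    have det': "(a - c) * d - (b - d) * c = 1" using det by (simp add: algebra_simps)
    have "\<bar>a - c\<bar> < \<bar>a\<bar>" using 2 by (auto simp: zero_less_mult_iff)
    then have "weber_2_law (a - c) (b - d) c d"
      by (intro less.hyps det' c) simp
    then show ?thesis using weber_2_law_T[OF det' c] by simp
  next
    case 3
    have det': "(a + c) * d - (b + d) * c = 1" using det by (simp add: algebra_simps)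
    have "\<bar>a + c\<bar> < \<bar>a\<bar>" using 3 by (auto simp: mult_less_0_iff)
    then have "weber_2_law (a + c) (b + d) c d"
      by (intro less.hyps det' c) simp
    then show ?thesis using weber_2_law_T[OF det c] by simp
  next
    case 4
    have det': "a * (d - 2 * b) - b * (c - 2 * a) = 1" using det by (simp add: algebra_simps)
    have c': "even (c - 2 * a)" using c by simp
    have "\<bar>c - 2 * a\<bar> < \<bar>c\<bar>" using 4 by (auto simp: zero_less_mult_iff)
    then have "weber_2_law a b (c - 2 * a) (d - 2 * b)"
      by (intro less.hyps det' c') simp
    then show ?thesis using weber_2_law_L[OF det' c'] by simp
  next
    case 5
    have det': "a * (d + 2 * b) - b * (c + 2 * a) = 1" using det by (simp add: algebra_simps)
    have c': "even (c + 2 * a)" using c by simp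
    have "\<bar>c + 2 * a\<bar> < \<bar>c\<bar>" using 5 by (auto simp: mult_less_0_iff)
    then have "weber_2_law a b (c + 2 * a) (d + 2 * b)"
      by (intro less.hyps det' c') simp
    then show ?thesis using weber_2_law_L[OF det c] by simp
  qed
qed

subsection \<open>The kernel group\<close>

definition weber_invariant :: "nat \<Rightarrow> int \<Rightarrow> int \<Rightarrow> int \<Rightarrow> int \<Rightarrow> bool" where
  "weber_invariant i a b c d \<longleftrightarrow>
     (\<forall>\<tau>. Im \<tau> > 0 \<longrightarrow> weber_cube i (moebius a b c d \<tau>) = weber_cube i \<tau>)"

lemma moebius_S: "moebius 0 (- 1) 1 0 \<tau> = - 1 / \<tau>"
  by (simp add: moebius_def)

text \<open>The factor in the law is constant and \<open>weber_cube 2\<close> has no zeros, so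
  evaluation at the single point \<open>\<i>\<close> shows that the factor must be 1.\<close>

lemma weber_invariant_2_iff_even:
  assumes "a * d - b * c = 1" "even c"
  shows "weber_invariant 2 a b c d \<longleftrightarrow> 16 dvd weber_exponent a b c"
proof -
  have law: "weber_cube 2 (moebius a b c d \<tau>) = zeta16 powi weber_exponent a b c * weber_cube 2 \<tau>"
    if "Im \<tau> > 0" for \<tau>
    using weber_2_law_even[OF assms] that by (simp only: weber_2_law_def)
  have "weber_invariant 2 a b c d \<longleftrightarrow> zeta16 powi weber_exponent a b c = 1"
  proof
    assume "weber_invariant 2 a b c d"
    then have "weber_cube 2 (moebius a b c d \<i>) = weber_cube 2 \<i>"
      by (simp only: weber_invariant_def) simp
    then show "zeta16 powi weber_exponent a b c = 1"
      using law[of \<i>] weber_cube_2_nonzero[of \<i>] by simp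
  qed (simp add: weber_invariant_def law)
  then show ?thesis by (simp only: zeta16_powi_eq_1_iff)
qed

text \<open>Otherwise \<open>weber_cube 1\<close> would be a multiple of
  \<open>weber_cube 2\<close>; but translation by 2 multiplies them by \<open>zeta16\<close> to the
  powers \<open>- 2\<close> and \<open>4\<close>, which would force
  \<open>zeta16 ^ 6 = 1\<close>.\<close>

lemma weber_cube_2_S_not_proportional:
  assumes "\<And>\<tau>. Im \<tau> > 0 \<Longrightarrow> weber_cube 2 (- 1 / \<tau>) = \<kappa> * weber_cube 2 \<tau>"
  shows False
proof -
  define k where "k = zeta16 ^ 6 * \<kappa>"
  have v: "weber_cube 1 \<tau> = k * weber_cube 2 \<tau>" if "Im \<tau> > 0" for \<tau>
    using weber_cube_2_S[OF that] assms[OF that] by (simp add: k_def field_simps)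
  have "weber_cube 1 (- 1 / \<i>) = zeta16 ^ 6 * weber_cube 2 \<i>"
    by (rule weber_cube_1_S) simp
  then have "k \<noteq> 0"
    using v[of "- 1 / \<i>"] weber_cube_2_nonzero[of \<i>] by auto
  have v1: "weber_cube 1 (\<i> + 2) = k * weber_cube 2 (\<i> + 2)" "weber_cube 1 \<i> = k * weber_cube 2 \<i>"
    by (rule v; simp)+
  have "weber_cube 2 (\<i> + 2) = zeta16 ^ 4 * weber_cube 2 \<i>"
    using weber_cube_2_plus_int[of \<i> 2] by simp
  moreover have "weber_cube 1 (\<i> + 2) = inverse (zeta16 ^ 2) * weber_cube 1 \<i>"
    by (rule weber_cube_1_plus_2)
  ultimately have "k * (zeta16 ^ 4 * weber_cube 2 \<i>) = inverse (zeta16 ^ 2) * (k * weber_cube 2 \<i>)"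
    by (simp only: v1)
  then have "zeta16 ^ 6 = 1"
    using \<open>k \<noteq> 0\<close> weber_cube_2_nonzero[of \<i>] by (simp add: field_simps power_numeral_reduce)
  then show False
    using zeta16_powi_eq_1_iff[of 6] by simp
qed

text \<open>For odd \<open>c\<close>, multiplying on the right by the inversion (\<open>d\<close>
  even) or by translation after inversion (\<open>d\<close> odd) makes the lower left entry even.
  The law together with invariance would then make \<open>weber_cube 2\<close> proportional to
  itself after inversion.\<close>

lemma weber_invariant_2_imp_even:
  assumes det: "a * d - b * c = 1" and inv: "weber_invariant 2 a b c d"
  shows "even c"
proof (rule ccontr)
  assume c: "odd c"
  have S: "Im (- 1 / \<tau>) > 0" if "Im \<tau> > 0" for \<tau>
    using that by (rule Im_minus_inverse_pos)
  show False
  proof (cases "even d")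
    case True
    have "weber_cube 2 (- 1 / \<tau>) = zeta16 powi weber_exponent b (- a) d * weber_cube 2 \<tau>"
      if \<tau>: "Im \<tau> > 0" for \<tau>
    proof -
      have det': "b * (- c) - (- a) * d = 1" using det by simp
      have "weber_cube 2 (moebius b (- a) d (- c) \<tau>) = zeta16 powi weber_exponent b (- a) d * weber_cube 2 \<tau>"
        using weber_2_law_even[OF det' True] \<tau> by (simp only: weber_2_law_def)
      also have "moebius b (- a) d (- c) \<tau> = moebius a b c d (moebius 0 (- 1) 1 0 \<tau>)"
        using \<tau> by (subst moebius_compose) simp_all
      finally show ?thesis
        using inv S[OF \<tau>] by (simp only: weber_invariant_def moebius_S)
    qed
    then show ?thesis by (rule weber_cube_2_S_not_proportional)
  next
    case False
    have "weber_cube 2 (- 1 / \<tau>) = inverse (zeta16 ^ 2) * zeta16 powi weber_exponent (a + b) (- a) (c + d) * weber_cube 2 \<tau>"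
      if \<tau>: "Im \<tau> > 0" for \<tau>
    proof -
      have det': "(a + b) * (- c) - (- a) * (c + d) = 1" using det by (simp add: algebra_simps)
      have "weber_cube 2 (moebius (a + b) (- a) (c + d) (- c) \<tau>) = zeta16 powi weber_exponent (a + b) (- a) (c + d) * weber_cube 2 \<tau>"
        using weber_2_law_even[OF det'] c False \<tau> by (simp add: weber_2_law_def)
      also have "moebius (a + b) (- a) (c + d) (- c) \<tau> = moebius a b c d (moebius 1 (- 1) 1 0 \<tau>)"
        using \<tau> by (subst moebius_compose) simp_all
      also have "moebius 1 (- 1) 1 0 \<tau> = - 1 / \<tau> + 1"
      proof -
        have "\<tau> \<noteq> 0" using \<tau> by auto
        then show ?thesis by (simp add: moebius_def field_simps)
      qed
      also have "weber_cube 2 (moebius a b c d (- 1 / \<tau> + 1)) = weber_cube 2 (- 1 / \<tau> + 1)"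
        using inv S[OF \<tau>] unfolding weber_invariant_def by auto
      also have "\<dots> = zeta16 ^ 2 * weber_cube 2 (- 1 / \<tau>)"
        by (rule weber_cube_2_plus_1)
      finally show ?thesis by (simp add: field_simps)
    qed
    then show ?thesis by (rule weber_cube_2_S_not_proportional)
  qed
qed

lemma weber_cube_1_conv_2: "Im \<tau> > 0 \<Longrightarrow> weber_cube 1 \<tau> = zeta16 ^ 6 * weber_cube 2 (- 1 / \<tau>)"
  by (simp only: weber_cube_2_S) simp

text \<open>\<open>weber_cube 1\<close> is a multiple of \<open>weber_cube 2\<close> after
  inversion, and the matrix on the right is the conjugate of the given one by the inversion.\<close>

lemma weber_invariant_1_iff:
  assumes det: "a * d - b * c = 1"
  shows "weber_invariant 1 a b c d \<longleftrightarrow> weber_invariant 2 d (- c) (- b) a"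
proof -
  have "weber_cube 1 (moebius a b c d \<tau>) = weber_cube 1 \<tau> \<longleftrightarrow>
      weber_cube 2 (moebius d (- c) (- b) a (- 1 / \<tau>)) = weber_cube 2 (- 1 / \<tau>)"
    if \<tau>: "Im \<tau> > 0" for \<tau>
  proof -
    have "moebius d (- c) (- b) a (- 1 / \<tau>) = moebius d (- c) (- b) a (moebius 0 (- 1) 1 0 \<tau>)"
      by (simp only: moebius_S)
    also have "\<dots> = moebius 0 (- 1) 1 0 (moebius a b c d \<tau>)"
      using \<tau> det by (subst (1 2) moebius_compose) simp_all
    finally have "moebius d (- c) (- b) a (- 1 / \<tau>) = - 1 / moebius a b c d \<tau>"
      by (simp only: moebius_S)
    then show ?thesis
      by (simp only: weber_cube_1_conv_2[OF \<tau>] weber_cube_1_conv_2[OF Im_moebius_pos[OF det \<tau>]]) simp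
  qed
  \<comment> \<open>Inversion is an involution of the upper half-plane, so it may be removed under
    the quantifier.\<close>
  moreover have "(\<forall>\<tau>. Im \<tau> > 0 \<longrightarrow> P (- 1 / \<tau>)) \<longleftrightarrow> (\<forall>\<tau>. Im \<tau> > 0 \<longrightarrow> P \<tau>)" for P :: "complex \<Rightarrow> bool"
  proof (intro iffI allI impI)
    fix \<tau> :: complex
    assume P: "\<forall>\<tau>. Im \<tau> > 0 \<longrightarrow> P (- 1 / \<tau>)" and \<tau>: "Im \<tau> > 0"
    have "- 1 / (- 1 / \<tau>) = \<tau>" by simp
    with P Im_minus_inverse_pos[OF \<tau>] show "P \<tau>" by metis
  qed (use Im_minus_inverse_pos in blast)
  ultimately show ?thesis unfolding weber_invariant_def by simp
qed

lemma weber_cube_0_conv_2: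
  assumes "Im \<tau> > 0"
  shows "weber_cube 0 \<tau> = zeta16 ^ 4 * weber_cube 2 (moebius 0 (- 1) 1 1 \<tau>)"
proof -
  have "moebius 0 (- 1) 1 1 \<tau> = - 1 / (\<tau> + 1)" by (simp add: moebius_def)
  then have "zeta16 ^ 2 * weber_cube 0 \<tau> = zeta16 ^ 6 * weber_cube 2 (moebius 0 (- 1) 1 1 \<tau>)"
    using weber_cube_1_conv_2[of "\<tau> + 1"] weber_cube_1_plus_1[of \<tau>] assms by simp
  also have "\<dots> = zeta16 ^ 2 * (zeta16 ^ 4 * weber_cube 2 (moebius 0 (- 1) 1 1 \<tau>))"
    by (simp flip: mult.assoc power_add)
  finally show ?thesis by (simp only: mult_cancel_left) simp
qed

text \<open>The matrix in the assumption is the conjugate of the given one by \<open>R\<close>, the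
  matrix with rows \<open>(0, -1)\<close> and \<open>(1, 1)\<close> that carries
  \<open>weber_cube 2\<close> to a multiple of \<open>weber_cube 0\<close>.\<close>

lemma weber_invariant_0I:
  assumes det: "a * d - b * c = 1" and inv: "weber_invariant 2 (d - c) (- c) (a + c - b - d) (a + c)"
  shows "weber_invariant 0 a b c d"
  unfolding weber_invariant_def
proof (intro allI impI)
  fix \<tau> :: complex
  assume \<tau>: "Im \<tau> > 0"
  let ?R = "moebius 0 (- 1) 1 1"
  have "Im (?R \<tau>) > 0" using \<tau> by (intro Im_moebius_pos) auto
  with inv have "weber_cube 2 (moebius (d - c) (- c) (a + c - b - d) (a + c) (?R \<tau>)) = weber_cube 2 (?R \<tau>)"
    unfolding weber_invariant_def by blast
  also have "moebius (d - c) (- c) (a + c - b - d) (a + c) (?R \<tau>) = ?R (moebius a b c d \<tau>)"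
    using \<tau> det by (subst (1 2) moebius_compose) (simp_all add: algebra_simps)
  finally show "weber_cube 0 (moebius a b c d \<tau>) = weber_cube 0 \<tau>"
    by (simp only: weber_cube_0_conv_2[OF \<tau>] weber_cube_0_conv_2[OF Im_moebius_pos[OF det \<tau>]])
qed

section \<open>Congruences for the matrix entries\<close>

text \<open>As \<open>a * d\<close> is 1 modulo 64, \<open>(8 * s + 1) * (8 * t + 1)\<close> is 1
  modulo 128, which forces \<open>s + t\<close> to be even. Hence \<open>a ^ 2\<close> and
  \<open>d ^ 2\<close> agree modulo 16.\<close>

lemma odd_squares_cong:
  fixes a b c d s t :: int
  assumes det: "a * d - b * c = 1" and "8 dvd b" "8 dvd c"
    and s: "a ^ 2 = 8 * s + 1" and t: "d ^ 2 = 8 * t + 1"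
  shows "even (s + t)"
proof -
  obtain k l where k: "b = 8 * k" and l: "c = 8 * l" using assms(2,3) by (elim dvdE)
  have ad: "a * d = 1 + 64 * (k * l)" using det by (simp add: k l)
  have "(8 * s + 1) * (8 * t + 1) = (a * d) ^ 2"
    by (simp add: power_mult_distrib s t)
  also have "\<dots> = 1 + 128 * (k * l) + 4096 * (k * l) ^ 2"
    unfolding ad by (simp add: power2_eq_square algebra_simps)
  finally have "8 * (s + t) = 8 * (2 * (8 * (k * l) + 256 * (k * l) ^ 2 - 4 * (s * t)))"
    by (simp add: algebra_simps)
  then show ?thesis by (metis dvd_triv_left mult_left_cancel zero_neq_numeral)
qed

text \<open>Modulo 8 the exponents reduce to odd multiples of \<open>2 * b + c\<close> and
  \<open>2 * c + b\<close>, so 8 divides \<open>b\<close> and \<open>c\<close>. Modulo 16 the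
  conditions then compare the parities of \<open>c / 8\<close> with \<open>s\<close> and of
  \<open>b / 8\<close> with \<open>t\<close>, and \<open>s\<close>, \<open>t\<close> have equal
  parity.\<close>

lemma weber_exponents_cong_imp:
  assumes det: "a * d - b * c = 1" and even: "even b" "even c"
    and N: "16 dvd weber_exponent a b c" "16 dvd weber_exponent d (- c) (- b)"
  shows "[b = a ^ 2 - 1] (mod 16)" "[c = a ^ 2 - 1] (mod 16)"
proof -
  note odd = odd_diagonal[OF det even(2)]
  obtain s t where s: "a ^ 2 = 8 * s + 1" and t: "d ^ 2 = 8 * t + 1"
    using odd_square_eq[OF odd(1)] odd_square_eq[OF odd(2)] by metis
  have co: "coprime (2 ^ 3) a" "coprime (2 ^ 3) d"
    using odd by (simp_all only: coprime_power_left_iff coprime_left_2_iff_odd) simp_all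
  have N1: "weber_exponent a b c = a * (2 * b + c) + 8 * s"
    by (simp add: weber_exponent_def s algebra_simps)
  have N2: "weber_exponent d (- c) (- b) = - (d * (2 * c + b)) + 8 * t"
    by (simp add: weber_exponent_def t algebra_simps)
  have "8 dvd weber_exponent a b c" "8 dvd weber_exponent d (- c) (- b)"
    using N by (auto intro: dvd_trans[of 8 16])
  moreover have "a * (2 * b + c) = weber_exponent a b c - 8 * s"
    "d * (2 * c + b) = 8 * t - weber_exponent d (- c) (- b)"
    by (simp_all add: N1 N2)
  ultimately have "2 ^ 3 dvd a * (2 * b + c)" "2 ^ 3 dvd d * (2 * c + b)"
    by (simp_all only:) (intro dvd_diff; simp)+
  then have "8 dvd 2 * b + c" "8 dvd 2 * c + b"
    using co by (simp_all add: coprime_dvd_mult_right_iff)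
  \<comment> \<open>The linear system has determinant 3, a unit modulo 8.\<close>
  then have b8: "8 dvd b" and c8: "8 dvd c" by presburger+
  then obtain k l where k: "b = 8 * k" and l: "c = 8 * l" by (elim dvdE)
  have st: "even (s + t)"
    by (rule odd_squares_cong[OF det b8 c8 s t])
  obtain p r where "a * (2 * b + c) + 8 * s = 16 * p" "- (d * (2 * c + b)) + 8 * t = 16 * r"
    using N unfolding N1 N2 by (elim dvdE)
  then have "2 * (a * k) + a * l + s = 2 * p" "- (2 * (d * l) + d * k) + t = 2 * r"
    unfolding k l by (simp_all add: algebra_simps)
  then have "even (2 * (a * k) + a * l + s)" "even (- (2 * (d * l) + d * k) + t)"
    by (simp_all only: dvd_triv_left)
  then have "even (l + s)" "even (k + t)"
    using odd by auto
  then have "even (k - s)" "even (l - s)" using st by auto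
  then obtain x y where "k - s = 2 * x" "l - s = 2 * y" by (elim evenE)
  then have "b - (a ^ 2 - 1) = 16 * x" "c - (a ^ 2 - 1) = 16 * y"
    unfolding k l s by simp_all
  then show "[b = a ^ 2 - 1] (mod 16)" "[c = a ^ 2 - 1] (mod 16)"
    unfolding cong_iff_dvd_diff by (simp_all only: dvd_triv_left)
qed

text \<open>The converse direction: after writing \<open>b = 8 * (s + 2 * x)\<close> and
  \<open>c = 8 * (s + 2 * y)\<close>, a factor 16 can be taken out of each exponent. The last one
  belongs to the conjugate matrix for index 0.\<close>

lemma weber_exponents_dvd:
  assumes det: "a * d - b * c = 1" and "even b"
    and b: "[b = a ^ 2 - 1] (mod 16)" and c: "[c = a ^ 2 - 1] (mod 16)"
  shows "even c" "even (a + c - b - d)" "16 dvd weber_exponent a b c" "16 dvd weber_exponent d (- c) (- b)"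
    "16 dvd weber_exponent (d - c) (- c) (a + c - b - d)"
proof -
  obtain x y where x: "b = a ^ 2 - 1 + 16 * x" and y: "c = a ^ 2 - 1 + 16 * y"
    using b c by (metis cong_iff_lin cong_sym)
  have "even (a ^ 2 - 1)" using \<open>even b\<close> x by simp
  then show "even c" using y by simp
  note odd = odd_diagonal[OF det \<open>even c\<close>]
  then show "even (a + c - b - d)" using \<open>even b\<close> \<open>even c\<close> by simp
  obtain s t where s: "a ^ 2 = 8 * s + 1" and t: "d ^ 2 = 8 * t + 1"
    using odd_square_eq[OF odd(1)] odd_square_eq[OF odd(2)] by metis
  obtain m n where m: "a = 2 * m + 1" and n: "d = 2 * n + 1" using odd by (elim oddE)
  have b': "b = 8 * (s + 2 * x)" and c': "c = 8 * (s + 2 * y)" using x y s by simp_all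
  have "even (s + t)"
    by (rule odd_squares_cong[OF det _ _ s t]) (simp_all add: b' c')
  then obtain r where r: "t = 2 * r - s" by (metis add_diff_cancel_left' evenE)
  have "weber_exponent a b c = 2 * a * b + a * c + 8 * s"
    by (simp add: weber_exponent_def s)
  also have "\<dots> = 16 * (a * (s + 2 * x) + a * y + s * (m + 1))"
    unfolding b' c' by (simp add: m algebra_simps)
  finally show "16 dvd weber_exponent a b c" by simp
  have "weber_exponent d (- c) (- b) = - (2 * d * c) - d * b + 8 * t"
    by (simp add: weber_exponent_def t)
  also have "\<dots> = 16 * (- (d * (s + 2 * y)) - d * x - s * n + r - s)"
    unfolding b' c' by (simp add: n r algebra_simps)
  finally show "16 dvd weber_exponent d (- c) (- b)" by simp
  \<comment> \<open>Arranged so that the determinant cancels the constant and 16 divides each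
    remaining term: \<open>b\<close> and \<open>c\<close> are multiples of 8,
    \<open>a + 3 * d\<close> is even and \<open>c - b\<close> is a multiple of 16.\<close>
  have "weber_exponent (d - c) (- c) (a + c - b - d)
      = (a * d - b * c - 1) + b * c - c * (a + 3 * d) + 3 * c * c + (d - c) * (c - b)"
    by (simp add: weber_exponent_def power2_eq_square algebra_simps)
  also have "\<dots> = b * c - c * (a + 3 * d) + 3 * c * c + (d - c) * (c - b)"
    unfolding det by simp
  also have "\<dots> = 16 * (4 * (s + 2 * x) * (s + 2 * y) - (s + 2 * y) * (m + 3 * n + 2)
      + 12 * (s + 2 * y) * (s + 2 * y) + (d - c) * (y - x))"
  proof -
    have "c - b = 16 * (y - x)" by (simp add: b' c')
    moreover have "c * (a + 3 * d) = 16 * ((s + 2 * y) * (m + 3 * n + 2))"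
      unfolding c' m n by (simp add: algebra_simps)
    moreover have "b * c = 16 * (4 * (s + 2 * x) * (s + 2 * y))" "3 * c * c = 16 * (12 * (s + 2 * y) * (s + 2 * y))"
      unfolding b' c' by (simp_all add: algebra_simps)
    ultimately show ?thesis by (simp only: right_diff_distrib distrib_left mult.left_commute[of "d - c" 16])
  qed
  finally show "16 dvd weber_exponent (d - c) (- c) (a + c - b - d)" by simp
qed

text \<open>On the right, evenness of \<open>b\<close> serves to make \<open>a\<close> odd.\<close>

theorem weber_invariant_iff:
  assumes det: "a * d - b * c = 1"
  shows "(\<forall>i\<in>{0, 1, 2}. weber_invariant i a b c d) \<longleftrightarrow>
     even b \<and> [b = a ^ 2 - 1] (mod 16) \<and> [c = a ^ 2 - 1] (mod 16)"
proof
  assume inv: "\<forall>i\<in>{0, 1, 2}. weber_invariant i a b c d"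
  have det': "d * a - (- c) * (- b) = 1" using det by (simp add: algebra_simps)
  have inv2: "weber_invariant 2 a b c d" using inv by blast
  have "weber_invariant 1 a b c d" using inv by blast
  then have inv1: "weber_invariant 2 d (- c) (- b) a"
    by (simp only: weber_invariant_1_iff[OF det])
  have c: "even c" by (rule weber_invariant_2_imp_even[OF det inv2])
  have b: "even (- b)" by (rule weber_invariant_2_imp_even[OF det' inv1])
  show "even b \<and> [b = a ^ 2 - 1] (mod 16) \<and> [c = a ^ 2 - 1] (mod 16)"
    using weber_exponents_cong_imp[OF det _ c] b inv2 inv1
    by (simp add: weber_invariant_2_iff_even[OF det c] weber_invariant_2_iff_even[OF det' b])
next
  assume *: "even b \<and> [b = a ^ 2 - 1] (mod 16) \<and> [c = a ^ 2 - 1] (mod 16)"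
  note N = weber_exponents_dvd[OF det conjunct1[OF *] conjunct1[OF conjunct2[OF *]] conjunct2[OF conjunct2[OF *]]]
  have det': "d * a - (- c) * (- b) = 1" using det by (simp add: algebra_simps)
  have det'': "(d - c) * (a + c) - (- c) * (a + c - b - d) = 1" using det by (simp add: algebra_simps)
  have "weber_invariant 2 a b c d"
    using N by (simp add: weber_invariant_2_iff_even[OF det])
  moreover have "weber_invariant 1 a b c d"
    unfolding weber_invariant_1_iff[OF det] using N * by (subst weber_invariant_2_iff_even[OF det']) simp_all
  moreover have "weber_invariant 0 a b c d"
    using N by (intro weber_invariant_0I det) (subst weber_invariant_2_iff_even[OF det''], simp_all)
  ultimately show "\<forall>i\<in>{0, 1, 2}. weber_invariant i a b c d" by blast
qed

section \<open>From entries to matrices and to the quotient by signs\<close>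

definition matrix2 :: "int \<Rightarrow> int \<Rightarrow> int \<Rightarrow> int \<Rightarrow> int^2^2" where
  "matrix2 a b c d = vector [vector [a, b], vector [c, d]]"

lemma matrix2_nth [simp]:
  "matrix2 a b c d $ 1 $ 1 = a" "matrix2 a b c d $ 1 $ 2 = b"
  "matrix2 a b c d $ 2 $ 1 = c" "matrix2 a b c d $ 2 $ 2 = d"
  by (simp_all add: matrix2_def)

lemma matrix2_cases:
  obtains a b c d where "A = matrix2 a b c d"
  by (rule that[of "A $ 1 $ 1" "A $ 1 $ 2" "A $ 2 $ 1" "A $ 2 $ 2"]) (simp add: vec_eq_iff forall_2)

lemma matrix2_mult:
  "matrix2 a b c d ** matrix2 a' b' c' d' = matrix2 (a * a' + b * c') (a * b' + b * d') (c * a' + d * c') (c * b' + d * d')"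
  by (simp add: vec_eq_iff forall_2 matrix_matrix_mult_def sum_2)

lemma matrix2_uminus: "- matrix2 a b c d = matrix2 (- a) (- b) (- c) (- d)"
  by (simp add: vec_eq_iff forall_2)

lemma matrix2_in_SL2Z [simp]: "matrix2 a b c d \<in> carrier SL2Z \<longleftrightarrow> a * d - b * c = 1"
  by (simp add: SL2Z_def det_2)

lemma matrix2_in_principal_congruence_subgroup:
  "matrix2 a b c d \<in> principal_congruence_subgroup N \<longleftrightarrow> a * d - b * c = 1 \<and>
     [a = 1] (mod N) \<and> [b = 0] (mod N) \<and> [c = 0] (mod N) \<and> [d = 1] (mod N)"
  by (auto simp: principal_congruence_subgroup_def forall_2 mat_def)

lemma mult_SL2Z: "A \<otimes>\<^bsub>SL2Z\<^esub> B = A ** B"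
  by (simp add: SL2Z_def)

lemma to_PSL2Z_hom: "to_PSL2Z \<in> hom SL2Z PSL2Z"
  unfolding PSL2Z_def to_PSL2Z_def by (rule normal.r_coset_hom_Mod[OF normal_pm_one])

lemma group_hom_to_PSL2Z: "group_hom SL2Z PSL2Z to_PSL2Z"
  by (intro group_hom.intro group_SL2Z group_PSL2Z group_hom_axioms.intro to_PSL2Z_hom)

lemma to_PSL2Z_mult:
  assumes "A \<in> carrier SL2Z" "B \<in> carrier SL2Z"
  shows "to_PSL2Z (A ** B) = to_PSL2Z A \<otimes>\<^bsub>PSL2Z\<^esub> to_PSL2Z B"
  using hom_mult[OF to_PSL2Z_hom assms] by (simp only: mult_SL2Z)

lemma to_PSL2Z_eq: "to_PSL2Z A = {A, - A}"
proof -
  have "(- mat 1) ** A = - A"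
    by (simp add: vec_eq_iff forall_2 matrix_matrix_mult_def sum_2 mat_def)
  then show ?thesis by (auto simp: to_PSL2Z_def r_coset_def mult_SL2Z)
qed

lemma to_PSL2Z_uminus: "to_PSL2Z (- A) = to_PSL2Z A"
  by (auto simp: to_PSL2Z_eq)

lemma carrier_PSL2Z: "carrier PSL2Z = to_PSL2Z ` carrier SL2Z"
  by (auto simp: PSL2Z_def FactGroup_def RCOSETS_def to_PSL2Z_def)

text \<open>The lift of \<open>weber_kernel_8\<close> to matrices: the subgroup property and the
  congruences are proved here and carried over by \<open>to_PSL2Z\<close>.\<close>

definition weber_kernel_SL2Z :: "(int^2^2) set" where
  "weber_kernel_SL2Z = {A \<in> carrier SL2Z. \<forall>i\<in>{0, 1, 2}. \<forall>\<tau>\<in>upper_half_plane.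
     weber_cube i (moebius_action A \<tau>) = weber_cube i \<tau>}"

lemma moebius_action_matrix2: "moebius_action (matrix2 a b c d) = moebius a b c d"
  by (rule ext) (simp add: moebius_action_def moebius_def)

lemma moebius_action_mult:
  assumes "A \<in> carrier SL2Z" "B \<in> carrier SL2Z" "\<tau> \<in> upper_half_plane"
  shows "moebius_action (A ** B) \<tau> = moebius_action A (moebius_action B \<tau>)"
proof (cases A rule: matrix2_cases, cases B rule: matrix2_cases)
  fix a b c d a' b' c' d'
  assume "A = matrix2 a b c d" "B = matrix2 a' b' c' d'"
  with assms show ?thesis
    by (simp add: matrix2_mult moebius_action_matrix2 moebius_compose upper_half_plane_def)
qed

lemma moebius_action_upper_half_plane:
  assumes "A \<in> carrier SL2Z" "\<tau> \<in> upper_half_plane"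
  shows "moebius_action A \<tau> \<in> upper_half_plane"
  using assms by (cases A rule: matrix2_cases)
    (simp add: moebius_action_matrix2 Im_moebius_pos upper_half_plane_def)

lemma subgroup_weber_kernel_SL2Z: "subgroup weber_kernel_SL2Z SL2Z"
proof -
  interpret group SL2Z by (rule group_SL2Z)
  show ?thesis
  proof (rule subgroupI)
    show "weber_kernel_SL2Z \<subseteq> carrier SL2Z" by (auto simp: weber_kernel_SL2Z_def)
    have "moebius_action (mat 1) \<tau> = \<tau>" for \<tau>
      by (simp add: moebius_action_def mat_def)
    then have "mat 1 \<in> weber_kernel_SL2Z"
      by (simp add: weber_kernel_SL2Z_def SL2Z_def)
    then show "weber_kernel_SL2Z \<noteq> {}" by auto
  next
    fix A assume A: "A \<in> weber_kernel_SL2Z"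
    then have A': "A \<in> carrier SL2Z" by (simp add: weber_kernel_SL2Z_def)
    have "weber_cube i (moebius_action (inv\<^bsub>SL2Z\<^esub> A) \<tau>) = weber_cube i \<tau>"
      if "i \<in> {0, 1, 2}" and \<tau>: "\<tau> \<in> upper_half_plane" for i \<tau>
    proof -
      have "A ** inv\<^bsub>SL2Z\<^esub> A = mat 1"
        using r_inv[OF A'] by (simp add: SL2Z_def)
      then have "moebius_action A (moebius_action (inv\<^bsub>SL2Z\<^esub> A) \<tau>) = \<tau>"
        using moebius_action_mult[OF A' inv_closed[OF A'] \<tau>] by (simp add: moebius_action_def mat_def)
      \<comment> \<open>Invariance under \<open>A\<close>, read at the point to which the inverse
        moves \<open>\<tau>\<close>.\<close>
      moreover have "weber_cube i (moebius_action A (moebius_action (inv\<^bsub>SL2Z\<^esub> A) \<tau>)) =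
          weber_cube i (moebius_action (inv\<^bsub>SL2Z\<^esub> A) \<tau>)"
        using A that(1) moebius_action_upper_half_plane[OF inv_closed[OF A'] \<tau>]
        unfolding weber_kernel_SL2Z_def by blast
      ultimately show ?thesis by simp
    qed
    then show "inv\<^bsub>SL2Z\<^esub> A \<in> weber_kernel_SL2Z"
      unfolding weber_kernel_SL2Z_def using inv_closed[OF A'] by blast
  next
    fix A B assume A: "A \<in> weber_kernel_SL2Z" and B: "B \<in> weber_kernel_SL2Z"
    then have A': "A \<in> carrier SL2Z" and B': "B \<in> carrier SL2Z"
      by (simp_all add: weber_kernel_SL2Z_def)
    have "weber_cube i (moebius_action (A ** B) \<tau>) = weber_cube i \<tau>"
      if "i \<in> {0, 1, 2}" and \<tau>: "\<tau> \<in> upper_half_plane" for i \<tau>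
    proof -
      have "weber_cube i (moebius_action A (moebius_action B \<tau>)) = weber_cube i (moebius_action B \<tau>)"
        using A that(1) moebius_action_upper_half_plane[OF B' \<tau>]
        unfolding weber_kernel_SL2Z_def by blast
      also have "\<dots> = weber_cube i \<tau>"
        using B that unfolding weber_kernel_SL2Z_def by blast
      finally show ?thesis
        by (simp only: moebius_action_mult[OF A' B' \<tau>])
    qed
    then show "A \<otimes>\<^bsub>SL2Z\<^esub> B \<in> weber_kernel_SL2Z"
      unfolding weber_kernel_SL2Z_def using m_closed[OF A' B'] unfolding mult_SL2Z by blast
  qed
qed

lemma matrix2_in_weber_kernel:
  assumes "a * d - b * c = 1"
  shows "matrix2 a b c d \<in> weber_kernel_SL2Z \<longleftrightarrow>
     even b \<and> [b = a ^ 2 - 1] (mod 16) \<and> [c = a ^ 2 - 1] (mod 16)"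
  unfolding weber_invariant_iff[OF assms, symmetric] using assms
  by (auto simp: weber_kernel_SL2Z_def weber_invariant_def upper_half_plane_def moebius_action_matrix2)

lemma weber_kernel_8_eq: "weber_kernel_8 = to_PSL2Z ` weber_kernel_SL2Z"
  unfolding weber_kernel_8_def weber_kernel_SL2Z_def carrier_PSL2Z
  by (auto simp: to_PSL2Z_eq moebius_action_uminus)

section \<open>Generators of the kernel group\<close>

theorem proposition10:
  shows "weber_kernel_8 =
    generate PSL2Z
      (to_PSL2Z ` principal_congruence_subgroup 16 \<union>
       {to_PSL2Z (vector [vector [13, 8], vector [8, 5]])})"
proof -
  interpret PSL: group PSL2Z by (rule group_PSL2Z)
  define M where "M = matrix2 13 8 8 5"
  \<comment> \<open>The inverse of \<open>M\<close>.\<close>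
  define N where "N = matrix2 5 (- 8) (- 8) 13"
  define S where "S = to_PSL2Z ` principal_congruence_subgroup 16 \<union> {to_PSL2Z M}"
  define G where "G = generate PSL2Z S"
  have MN: "M \<in> carrier SL2Z" "N \<in> carrier SL2Z" by (simp_all add: M_def N_def)
  have "principal_congruence_subgroup 16 \<subseteq> carrier SL2Z"
    by (auto simp: principal_congruence_subgroup_def)
  then have S: "S \<subseteq> carrier PSL2Z" using MN by (auto simp: S_def carrier_PSL2Z)
  have sub: "subgroup G PSL2Z"
    unfolding G_def by (rule PSL.generate_is_subgroup[OF S])
  have "subgroup weber_kernel_8 PSL2Z"
    unfolding weber_kernel_8_eq
    by (rule group_hom.subgroup_img_is_subgroup[OF group_hom_to_PSL2Z subgroup_weber_kernel_SL2Z])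
  moreover have "S \<subseteq> weber_kernel_8"
  proof -
    have "A \<in> weber_kernel_SL2Z" if "A \<in> principal_congruence_subgroup 16" for A
    proof (cases A rule: matrix2_cases)
      case (1 a b c d)
      with that have A: "a * d - b * c = 1" "[a = 1] (mod 16)" "[b = 0] (mod 16)" "[c = 0] (mod 16)"
        by (auto simp: matrix2_in_principal_congruence_subgroup)
      have "[a ^ 2 - 1 = 1 ^ 2 - 1] (mod 16)"
        by (intro cong_diff cong_pow A cong_refl)
      then have "[a ^ 2 - 1 = 0] (mod 16)" by simp
      then have "[b = a ^ 2 - 1] (mod 16)" "[c = a ^ 2 - 1] (mod 16)"
        using A(3,4) by (metis cong_sym cong_trans)+
      moreover have "even b" using A(3) by (auto simp: cong_0_iff intro: dvd_trans[of 2 16])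
      ultimately show ?thesis using 1 matrix2_in_weber_kernel[OF A(1)] by simp
    qed
    moreover have "M \<in> weber_kernel_SL2Z"
      unfolding M_def by (subst matrix2_in_weber_kernel) (simp_all add: cong_def)
    ultimately show ?thesis unfolding S_def weber_kernel_8_eq by auto
  qed
  ultimately have "G \<subseteq> weber_kernel_8"
    unfolding G_def by (intro PSL.generate_subgroup_incl)
  moreover have "to_PSL2Z A \<in> G" if "A \<in> weber_kernel_SL2Z" for A
  proof -
    have cong: "to_PSL2Z B \<in> G" if "B \<in> principal_congruence_subgroup 16" for B
      using that unfolding G_def by (intro generate.incl) (simp add: S_def)
    have M: "to_PSL2Z M \<in> G"
      unfolding G_def by (intro generate.incl) (simp add: S_def)
    have NM: "N ** M = mat 1" "M ** N = mat 1"
      by (simp_all add: M_def N_def matrix2_mult vec_eq_iff forall_2 mat_def)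
    have "to_PSL2Z N = inv\<^bsub>PSL2Z\<^esub> (to_PSL2Z M)"
    proof (rule PSL.inv_equality[symmetric])
      have "to_PSL2Z N \<otimes>\<^bsub>PSL2Z\<^esub> to_PSL2Z M = to_PSL2Z \<one>\<^bsub>SL2Z\<^esub>"
        using to_PSL2Z_mult[OF MN(2,1)] NM by (simp add: SL2Z_def)
      then show "to_PSL2Z N \<otimes>\<^bsub>PSL2Z\<^esub> to_PSL2Z M = \<one>\<^bsub>PSL2Z\<^esub>"
        by (simp add: group_hom.hom_one[OF group_hom_to_PSL2Z])
    qed (use MN in \<open>auto simp: carrier_PSL2Z\<close>)
    then have N: "to_PSL2Z N \<in> G"
      using subgroup.m_inv_closed[OF sub M] by simp
    have cancel_M: "to_PSL2Z B \<in> G" if "B \<in> carrier SL2Z" "to_PSL2Z (B ** M) \<in> G" for B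
    proof -
      have "B = (B ** M) ** N" by (simp add: NM flip: matrix_mul_assoc)
      moreover have "B ** M \<in> carrier SL2Z" using that(1) MN by (simp add: SL2Z_def det_mul)
      ultimately have "to_PSL2Z B = to_PSL2Z (B ** M) \<otimes>\<^bsub>PSL2Z\<^esub> to_PSL2Z N"
        using to_PSL2Z_mult MN by metis
      then show ?thesis using subgroup.m_closed[OF sub that(2) N] by simp
    qed
    \<comment> \<open>Membership may be tested after right multiplication by \<open>M\<close>.
      Modulo 16 this moves the upper left entry along 13, 9, 5, 1 within the classes of the powers
      of \<open>M\<close>, so \<open>r13\<close>, \<open>r9\<close>, \<open>r5\<close> reduce one to
      the next and end in \<open>r1\<close>, the case of the congruence subgroup.\<close>
    have step: "to_PSL2Z (matrix2 a b c d) \<in> G"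
      if "a * d - b * c = 1" "to_PSL2Z (matrix2 (a * 13 + b * 8) (a * 8 + b * 5) (c * 13 + d * 8) (c * 8 + d * 5)) \<in> G"
      for a b c d
      using that by - (rule cancel_M, simp_all only: matrix2_in_SL2Z M_def matrix2_mult)
    have det_step: "(a * 13 + b * 8) * (c * 8 + d * 5) - (a * 8 + b * 5) * (c * 13 + d * 8) = 1"
      if "a * d - b * c = 1" for a b c d :: int
      using that by (simp add: algebra_simps)
    have lin: "(x * p + y * q) mod 16 = ((x mod 16) * p + (y mod 16) * q) mod 16" for x y p q :: int
      by (intro mod_add_cong mod_mult_left_eq[symmetric])
    have r1: "to_PSL2Z (matrix2 a b c d) \<in> G"
      if "a * d - b * c = 1" "a mod 16 = 1" "b mod 16 = 0" "c mod 16 = 0" "d mod 16 = 1" for a b c d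
      using that by (intro cong) (simp add: matrix2_in_principal_congruence_subgroup cong_def)
    have r5: "to_PSL2Z (matrix2 a b c d) \<in> G"
      if "a * d - b * c = 1" "a mod 16 = 5" "b mod 16 = 8" "c mod 16 = 8" "d mod 16 = 13" for a b c d
      by (rule step[OF that(1)], rule r1[OF det_step[OF that(1)]]) (simp_all only: lin[of a _ b] lin[of c _ d] that(2-), simp_all)
    have r9: "to_PSL2Z (matrix2 a b c d) \<in> G"
      if "a * d - b * c = 1" "a mod 16 = 9" "b mod 16 = 0" "c mod 16 = 0" "d mod 16 = 9" for a b c d
      by (rule step[OF that(1)], rule r5[OF det_step[OF that(1)]]) (simp_all only: lin[of a _ b] lin[of c _ d] that(2-), simp_all)
    have r13: "to_PSL2Z (matrix2 a b c d) \<in> G"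
      if "a * d - b * c = 1" "a mod 16 = 13" "b mod 16 = 8" "c mod 16 = 8" "d mod 16 = 5" for a b c d
      by (rule step[OF that(1)], rule r9[OF det_step[OF that(1)]]) (simp_all only: lin[of a _ b] lin[of c _ d] that(2-), simp_all)
    \<comment> \<open>For \<open>a\<close> congruent to 1 modulo 4, its residue modulo 16 determines
      those of \<open>b\<close> and \<open>c\<close> by the congruences and that of \<open>d\<close>
      by the determinant; the four resulting classes are those of the powers of
      \<open>M\<close>.\<close>
    have reps: "to_PSL2Z (matrix2 a b c d) \<in> G"
      if det: "a * d - b * c = 1" and abc: "b mod 16 = (a ^ 2 - 1) mod 16" "c mod 16 = (a ^ 2 - 1) mod 16"
        and a: "a mod 4 = 1" for a b c d
    proof -
      have sq: "(a ^ 2 - 1) mod 16 = ((a mod 16) ^ 2 - 1) mod 16"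
        by (intro mod_diff_cong power_mod[symmetric] refl)
      have "((a mod 16) * d) mod 16 = (a * d) mod 16" by (rule mod_mult_left_eq)
      also have "a * d = 1 + b * c" using det by simp
      also have "(1 + b * c) mod 16 = (1 + (b mod 16) * (c mod 16)) mod 16"
        by (intro mod_add_cong mod_mult_eq[symmetric] refl)
      finally have d: "((a mod 16) * d) mod 16 = (1 + (b mod 16) * (c mod 16)) mod 16" .
      \<comment> \<open>Uniqueness of inverses modulo 16, with \<open>y\<close> the residue of
        \<open>a\<close>.\<close>
      have d_mod: "d mod 16 = x mod 16" if "(y * d) mod 16 = 1" "(y * x) mod 16 = 1" for x y
      proof -
        have "d mod 16 = ((y * x) mod 16 * d) mod 16" by (simp add: that)
        also have "\<dots> = (y * x * d) mod 16" by (rule mod_mult_left_eq)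
        also have "y * x * d = x * (y * d)" by simp
        also have "\<dots> mod 16 = (x * ((y * d) mod 16)) mod 16" by (rule mod_mult_right_eq[symmetric])
        finally show ?thesis by (simp add: that)
      qed
      have "a mod 16 = 1 \<or> a mod 16 = 5 \<or> a mod 16 = 9 \<or> a mod 16 = 13"
      proof -
        have "r = 1 \<or> r = 5 \<or> r = 9 \<or> r = 13" if "r mod 4 = 1" "0 \<le> r" "r < 16" for r :: int
          using that by presburger
        moreover have "a mod 16 mod 4 = 1" using a by (simp add: mod_mod_cancel)
        ultimately show ?thesis by simp
      qed
      then consider "a mod 16 = 1" | "a mod 16 = 5" | "a mod 16 = 9" | "a mod 16 = 13"
        by blast
      then show ?thesis
      proof cases
        case 1
        then have bc: "b mod 16 = 0" "c mod 16 = 0" using abc sq by simp_all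
        then have "d mod 16 = 1" using d 1 by simp
        then show ?thesis by (intro r1 det 1 bc)
      next
        case 2
        then have bc: "b mod 16 = 8" "c mod 16 = 8" using abc sq by simp_all
        then have "(5 * d) mod 16 = 1" using d 2 by simp
        then have "d mod 16 = 13" using d_mod[of 5 13] by simp
        then show ?thesis by (intro r5 det 2 bc)
      next
        case 3
        then have bc: "b mod 16 = 0" "c mod 16 = 0" using abc sq by simp_all
        then have "(9 * d) mod 16 = 1" using d 3 by simp
        then have "d mod 16 = 9" using d_mod[of 9 9] by simp
        then show ?thesis by (intro r9 det 3 bc)
      next
        case 4
        then have bc: "b mod 16 = 8" "c mod 16 = 8" using abc sq by simp_all
        then have "(13 * d) mod 16 = 1" using d 4 by simp
        then have "d mod 16 = 5" using d_mod[of 13 5] by simp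
        then show ?thesis by (intro r13 det 4 bc)
      qed
    qed
    obtain a b c d where A: "A = matrix2 a b c d" by (rule matrix2_cases)
    with that have det: "a * d - b * c = 1" by (simp add: weber_kernel_SL2Z_def)
    have abc: "even b" "b mod 16 = (a ^ 2 - 1) mod 16" "c mod 16 = (a ^ 2 - 1) mod 16"
      using that unfolding A matrix2_in_weber_kernel[OF det] cong_def by auto
    have "16 dvd b - (a ^ 2 - 1)" using abc(2) by (simp only: mod_eq_dvd_iff)
    then have "even (b - (a ^ 2 - 1))" by (rule dvd_trans[rotated]) simp
    then have "odd a" using abc(1) by simp
    \<comment> \<open>The sign is free in the quotient, so the second case passes to the negated
      matrix.\<close>
    then have "a mod 4 = 1 \<or> (- a) mod 4 = 1" by presburger
    then consider "a mod 4 = 1" | "(- a) mod 4 = 1" by blast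
    then show ?thesis
    proof cases
      case 1
      then show ?thesis unfolding A by (intro reps det abc)
    next
      case 2
      have "(- b) mod 16 = ((- a) ^ 2 - 1) mod 16" "(- c) mod 16 = ((- a) ^ 2 - 1) mod 16"
      proof -
        obtain s where "a ^ 2 = 8 * s + 1" by (rule odd_square_eq[OF \<open>odd a\<close>])
        then have s: "(- a) ^ 2 - 1 = 8 * s" "a ^ 2 - 1 = 8 * s" by simp_all
        \<comment> \<open>Because \<open>8 * s\<close> and \<open>- 8 * s\<close> agree modulo 16,
          negation preserves the congruences.\<close>
        have "(- x) mod 16 = (8 * s) mod 16" if "x mod 16 = (8 * s) mod 16" for x
        proof -
          have "16 dvd x - 8 * s" using that by (simp only: mod_eq_dvd_iff)
          then have "16 dvd - (x - 8 * s) - 16 * s" by (intro dvd_diff) (simp_all only: dvd_minus_iff dvd_triv_left)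
          also have "- (x - 8 * s) - 16 * s = - x - 8 * s" by simp
          finally show ?thesis by (simp only: mod_eq_dvd_iff)
        qed
        then show "(- b) mod 16 = ((- a) ^ 2 - 1) mod 16" "(- c) mod 16 = ((- a) ^ 2 - 1) mod 16"
          using abc(2,3) unfolding s by blast+
      qed
      then have "to_PSL2Z (matrix2 (- a) (- b) (- c) (- d)) \<in> G"
        using det 2 by (intro reps) simp_all
      then show ?thesis unfolding A matrix2_uminus[symmetric] to_PSL2Z_uminus .
    qed
  qed
  ultimately show ?thesis
    unfolding weber_kernel_8_eq G_def S_def M_def matrix2_def by auto
qed

end
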